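(* For every integer $n\geqslant 2$, \[ \frac{45}{32}-\log\log 32\;\leqslant\;\frac{1}{n}\sum_{k\leqslant n}\omega(k)-\log\log n\;\leqslant\;\frac{1}{2}-\log\log 2 . \] The constants are best possible: equality holds in the left inequality only for $n=32$, and in the right inequality only for $n=2$.
   Context: $\omega(k)$ denotes the number of distinct prime divisors of the positive integer $k$. *)

theory Defs
  imports Complex_Main "HOL-Computational_Algebra.Primes"
begin

definition omega :: "nat \<Rightarrow> nat" where
  "omega k = card (prime_factors k)"

end

theory Submission
  imports Defs "HOL-Analysis.Harmonic_Numbers"
begin

text \<open>
  Counting multiples, the sum of \<open>\<omega>(k)\<close> over \<open>k \<le> n\<close> is the sum of \<open>\<lfloor>n/p\<rfloor>\<close> over primes \<open>p \<le> n\<close>.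
  Legendre's formula for \<open>n!\<close> and Chebyshev's bound \<open>\<theta>(n) \<le> n log 4\<close> give two-sided bounds for the sums of
  \<open>log p / p\<close> and of \<open>log p \<lfloor>n/p\<rfloor>\<close>, and summation by parts, started at a base point \<open>a\<close> up to which the
  primes are treated individually, turns these into explicit bounds with main term \<open>log log n\<close>.
  The upper bound has a lot of room, so that \<open>a = 32\<close> suffices. The lower bound is nearly attained at many
  small \<open>n\<close> and loses about \<open>0.42 / log a\<close> against Mertens' constant \<open>0.2615\<close>; with \<open>a = 1024\<close> this stays
  above the claimed constant \<open>0.1633\<close> for \<open>n \<ge> 1024\<close>. For smaller \<open>n\<close> one uses that
  the sum of \<open>\<lfloor>n/p\<rfloor>\<close> increases with \<open>n\<close>, so that finitely many intervals can be checked numerically.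
\<close>

section \<open>Prime sums and factorials\<close>

abbreviation primes_le :: "nat \<Rightarrow> nat set" where
  "primes_le n \<equiv> {p. prime p \<and> p \<le> n}"

lemma finite_primes_le: "finite (primes_le n)"
  by (rule finite_subset[of _ "{..n}"]) auto

lemma primes_le_Suc: "primes_le (Suc n) = (if prime (Suc n) then insert (Suc n) (primes_le n) else primes_le n)"
  by (auto simp: le_Suc_eq)

lemma card_multiples: "p > 0 \<Longrightarrow> card {k\<in>{1..n}. p dvd k} = n div p" for p n :: nat
proof -
  assume p: "p > 0"
  have "{k\<in>{1..n}. p dvd k} = (\<lambda>i. p * i) ` {1..n div p}"
  proof (intro equalityI subsetI)
    fix k assume k: "k \<in> {k\<in>{1..n}. p dvd k}"
    then obtain i where "k = p * i" by auto
    with k p show "k \<in> (\<lambda>i. p * i) ` {1..n div p}"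
      by (auto simp: less_eq_div_iff_mult_less_eq mult.commute intro!: imageI)
  next
    fix k assume "k \<in> (\<lambda>i. p * i) ` {1..n div p}"
    with p show "k \<in> {k\<in>{1..n}. p dvd k}"
      by (auto simp: less_eq_div_iff_mult_less_eq mult.commute)
  qed
  moreover have "inj_on (\<lambda>i. p * i) {1..n div p}" using p by (auto intro: inj_onI)
  ultimately show ?thesis by (simp add: card_image)
qed

lemma sum_omega:
  "(\<Sum>k=1..n. real (omega k)) = (\<Sum>p\<in>primes_le n. real (n div p))"
proof -
  have "real (omega k) = (\<Sum>p\<in>primes_le n. of_bool (p dvd k))" if "k \<in> {1..n}" for k
  proof -
    have "prime_factors k = {p\<in>primes_le n. p dvd k}"
      using that by (auto simp: prime_factors_dvd dest: dvd_imp_le)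
    then show ?thesis
      using finite_primes_le by (simp add: omega_def of_bool_def sum.If_cases Int_def)
  qed
  then have "(\<Sum>k=1..n. real (omega k)) = (\<Sum>k=1..n. \<Sum>p\<in>primes_le n. of_bool (p dvd k))"
    by (intro sum.cong) auto
  also have "\<dots> = (\<Sum>p\<in>primes_le n. \<Sum>k=1..n. of_bool (p dvd k))"
    by (rule sum.swap)
  also have "\<dots> = (\<Sum>p\<in>primes_le n. real (n div p))"
  proof (intro sum.cong refl)
    fix p assume "p \<in> primes_le n"
    then have "p > 0" by (auto intro: prime_gt_0_nat)
    then have "card ({1..n} \<inter> {k. p dvd k}) = n div p"
      using card_multiples[of p n] by (simp add: Int_def)
    then show "(\<Sum>k=1..n. of_bool (p dvd k)) = real (n div p)"
      by (simp add: of_bool_def sum.If_cases)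
  qed
  finally show ?thesis .
qed

section \<open>Elementary Stirling bounds\<close>

lemma ln_Suc_le: "ln (real (Suc n)) \<le> ln (real n) + 1 / real n" if "n > 0"
proof -
  have "ln (1 + 1 / real n) \<le> 1 / real n" by (rule ln_add_one_self_le_self) simp
  moreover have "1 + 1 / real n = real (Suc n) / real n" using that by (simp add: field_simps)
  ultimately show ?thesis using that by (simp add: ln_div del: of_nat_Suc)
qed

lemma ln_Suc_ge: "ln (real (Suc n)) \<ge> ln (real n) + 1 / real (Suc n)" if "n > 0"
proof -
  have "ln (real n / real (Suc n)) \<le> real n / real (Suc n) - 1"
    using that by (intro ln_le_minus_one) auto
  also have "\<dots> = - (1 / real (Suc n))" by (simp add: field_simps)
  finally show ?thesis using that by (simp add: ln_div del: of_nat_Suc)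
qed

text \<open>Induction with \<open>ln_Suc_le\<close>. The argument \<open>Suc n\<close> of the
  logarithm is kept because \<open>ln_Suc_mult_inverse_ln_diff_ge\<close> needs
  \<open>ln (Suc j)\<close> to reach the increments of log log from above.\<close>

lemma ln_fact_ge: "real n * (ln (real (Suc n)) - 1) \<le> ln (fact n)"
proof (induction n)
  case (Suc n)
  have "real (Suc n) * ln (real (Suc (Suc n))) \<le> real (Suc n) * (ln (real (Suc n)) + 1 / real (Suc n))"
    by (intro mult_left_mono ln_Suc_le) auto
  also have "\<dots> = real (Suc n) * ln (real (Suc n)) + 1" by (simp add: field_simps)
  finally have "real (Suc n) * ln (real (Suc (Suc n))) \<le> real (Suc n) * ln (real (Suc n)) + 1" .
  moreover have "ln (fact (Suc n)) = ln (real (Suc n)) + ln (fact n)"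
    by (simp add: ln_mult del: of_nat_Suc)
  ultimately show ?case using Suc by (simp add: algebra_simps)
qed simp

lemma ln_fact_le: "ln (fact n) \<le> real n * ln (real n) - real n + 1 + ln (real n)" if "n > 0"
  using that
proof (induction n rule: nat_induct_non_zero)
  case (Suc n)
  have "real (Suc n) * ln (real (Suc n)) \<ge> real (Suc n) * (ln (real n) + 1 / real (Suc n))"
    using Suc by (intro mult_left_mono ln_Suc_ge) auto
  moreover have "real (Suc n) * (ln (real n) + 1 / real (Suc n)) = real (Suc n) * ln (real n) + 1"
    by (simp add: field_simps)
  moreover have "ln (fact (Suc n)) = ln (real (Suc n)) + ln (fact n)"
    by (simp add: ln_mult del: of_nat_Suc)
  ultimately show ?case using Suc by (simp add: algebra_simps)
qed simp

section \<open>Legendre's formula\<close>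

lemma ln_fact_eq_sum_primes:
  "ln (fact n) = (\<Sum>p\<in>primes_le n. ln (real p) * real (multiplicity p (fact n :: nat)))"
proof -
  have "fact n = (\<Prod>p\<in>prime_factors (fact n :: nat). p ^ multiplicity p (fact n :: nat))"
    by (rule prime_factorization_nat) simp
  moreover have "prime_factors (fact n :: nat) = primes_le n"
    by (auto simp: prime_factors_dvd prime_dvd_fact_iff)
  ultimately have "real (fact n) = (\<Prod>p\<in>primes_le n. real p ^ multiplicity p (fact n :: nat))"
    by (metis (no_types, lifting) of_nat_power of_nat_prod prod.cong)
  then have "ln (fact n) = ln (\<Prod>p\<in>primes_le n. real p ^ multiplicity p (fact n :: nat))" by simp
  also have "\<dots> = (\<Sum>p\<in>primes_le n. ln (real p ^ multiplicity p (fact n :: nat)))"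
    by (rule ln_prod) (auto simp: finite_primes_le prime_gt_0_nat)
  also have "\<dots> = (\<Sum>p\<in>primes_le n. ln (real p) * real (multiplicity p (fact n :: nat)))"
    by (intro sum.cong refl) (auto simp: ln_realpow prime_gt_0_nat)
  finally show ?thesis .
qed

text \<open>Count the pairs of \<open>i\<close> and \<open>k\<close> with \<open>p ^ i dvd k\<close>
  in both orders. The range of \<open>i\<close> may stop at \<open>n\<close>, since
  \<open>p ^ i dvd k\<close> forces \<open>i < p ^ i \<le> k \<le> n\<close>.\<close>

lemma multiplicity_fact:
  fixes p :: nat
  assumes "prime p"
  shows "multiplicity p (fact n :: nat) = (\<Sum>i=1..n. n div p ^ i)"
proof -
  have "multiplicity p (fact n :: nat) = (\<Sum>k=1..n. multiplicity p k)"
  proof -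
    have "multiplicity p (\<Prod>{1..n}) = (\<Sum>k\<in>{1..n}. multiplicity p k)"
      using assms by (intro prime_elem_multiplicity_prod_distrib) auto
    then show ?thesis by (simp add: fact_prod)
  qed
  also have "\<dots> = (\<Sum>k=1..n. \<Sum>i=1..n. of_bool (p ^ i dvd k))"
  proof (intro sum.cong refl)
    fix k assume k: "k \<in> {1..n}"
    have "{1..n} \<inter> {i. p ^ i dvd k} = {1..multiplicity p k}"
    proof -
      have "i \<le> n" if "p ^ i dvd k" for i
      proof -
        have "i < p ^ i" using prime_gt_1_nat[OF assms] by (intro power_gt_expt) auto
        also have "p ^ i \<le> k" using that k by (intro dvd_imp_le) auto
        finally show ?thesis using k by auto
      qed
      moreover have "p ^ i dvd k \<longleftrightarrow> i \<le> multiplicity p k" for i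
        using k assms by (intro power_dvd_iff_le_multiplicity) (auto simp: not_prime_unit)
      ultimately show ?thesis by auto
    qed
    then show "multiplicity p k = (\<Sum>i=1..n. of_bool (p ^ i dvd k))"
      by (simp add: of_bool_def sum.If_cases)
  qed
  also have "\<dots> = (\<Sum>i=1..n. \<Sum>k=1..n. of_bool (p ^ i dvd k))" by (rule sum.swap)
  also have "\<dots> = (\<Sum>i=1..n. n div p ^ i)"
  proof (intro sum.cong refl)
    fix i
    have "card ({1..n} \<inter> {k. p ^ i dvd k}) = n div p ^ i"
      using card_multiples[of "p ^ i" n] prime_gt_0_nat[OF assms] by (simp add: Int_def)
    then show "(\<Sum>k=1..n. of_bool (p ^ i dvd k)) = n div p ^ i"
      by (simp add: of_bool_def sum.If_cases)
  qed
  finally show ?thesis .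
qed

lemma multiplicity_fact_ge: "n div p \<le> multiplicity p (fact n :: nat)" if "prime p" for p :: nat
proof (cases "n = 0")
  case False
  have "n div p ^ 1 \<le> (\<Sum>i=1..n. n div p ^ i)"
    using False by (intro member_le_sum) auto
  then show ?thesis by (simp add: multiplicity_fact that)
qed simp

text \<open>The terms of Legendre's sum with \<open>i \<ge> 2\<close> are at most
  \<open>n / p ^ i\<close>, and the geometric series of \<open>1 / p ^ i\<close> from
  \<open>i = 2\<close> on has the value \<open>1 / (p * (p - 1))\<close>.\<close>

lemma multiplicity_fact_le:
  fixes p :: nat
  assumes "prime p"
  shows "real (multiplicity p (fact n :: nat)) \<le> real (n div p) + real n / (real p * (real p - 1))"
proof -
  have p: "real p > 1" using prime_gt_1_nat[OF assms] by simp
  \<comment> \<open>For \<open>m \<ge> 1\<close> the right side is the exact partial sum, so the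
    induction closes.\<close>
  have geo: "(\<Sum>i=2..m. 1 / real p ^ i) \<le> 1 / (real p * (real p - 1)) * (1 - (if m = 0 then 0 else 1 / real p ^ (m - 1)))" for m
  proof (induction m)
    case (Suc m)
    show ?case
    proof (cases "m = 0")
      case False
      then obtain k where k: "m = Suc k" by (cases m) auto
      have "1 / real p ^ Suc (Suc k) + 1 / (real p * (real p - 1)) * (1 - 1 / real p ^ k)
        = 1 / (real p * (real p - 1)) * (1 - 1 / real p ^ Suc k)"
        using p by (simp add: field_simps)
      then show ?thesis using Suc k by simp
    qed simp
  qed (use p in simp)
  have "real (multiplicity p (fact n :: nat)) \<le> real (n div p) + (\<Sum>i=2..n. real (n div p ^ i))"
  proof (cases "n = 0")
    case False
    then have "{1..n} = insert 1 {2..n}" by auto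
    then show ?thesis by (simp add: multiplicity_fact[OF assms])
  qed simp
  also have "(\<Sum>i=2..n. real (n div p ^ i)) \<le> (\<Sum>i=2..n. real n * (1 / real p ^ i))"
    by (intro sum_mono) (use of_nat_div_le_of_nat[of n] in \<open>simp flip: of_nat_power\<close>)
  also have "\<dots> = real n * (\<Sum>i=2..n. 1 / real p ^ i)" by (simp add: sum_distrib_left)
  also have "(\<Sum>i=2..n. 1 / real p ^ i) \<le> 1 / (real p * (real p - 1))"
  proof -
    have "1 / (real p * (real p - 1)) * (1 - (if n = 0 then 0 else 1 / real p ^ (n - 1))) \<le> 1 / (real p * (real p - 1)) * 1"
      using p by (intro mult_left_mono) auto
    then show ?thesis using geo[of n] by linarith
  qed
  finally show ?thesis by (simp add: mult_left_mono)
qed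

section \<open>Chebyshev's bound for theta\<close>

text \<open>The product is at most that of all prime divisors of \<open>N\<close>, and raising these
  to their multiplicities gives \<open>N\<close>.\<close>

lemma prod_primes_le:
  fixes A :: "nat set"
  assumes "N > 0" "\<And>p. p \<in> A \<Longrightarrow> prime p \<and> p dvd N"
  shows "\<Prod>A \<le> N"
proof -
  have "A \<subseteq> prime_factors N" using assms by (auto simp: prime_factors_dvd)
  then have "\<Prod>A \<le> \<Prod>(prime_factors N)"
    by (intro dvd_imp_le prod_dvd_prod_subset prod_pos) (auto intro!: prime_gt_0_nat)
  also have "\<dots> \<le> (\<Prod>p\<in>prime_factors N. p ^ multiplicity p N)"
  proof (intro prod_mono conjI)
    fix p assume p: "p \<in> prime_factors N"
    then have "p > 0" "multiplicity p N \<ge> 1"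
      using assms(1) by (auto simp: prime_factors_multiplicity dest: prime_gt_0_nat)
    then show "p \<le> p ^ multiplicity p N" by (simp add: self_le_power)
  qed simp
  also have "\<dots> = N" using assms by (intro prime_factorization_nat[symmetric])
  finally show ?thesis .
qed

text \<open>The two middle coefficients of row \<open>2 * m + 1\<close> are equal, and together at
  most the row sum \<open>2 * 4 ^ m\<close>.\<close>

lemma binomial_middle_le: "(2 * m + 1) choose m \<le> 4 ^ m"
proof -
  have "(\<Sum>k\<in>{m, m + 1}. (2 * m + 1) choose k) \<le> (\<Sum>k\<le>2 * m + 1. (2 * m + 1) choose k)"
    by (intro sum_mono2) auto
  also have "\<dots> = 2 * 4 ^ m" by (subst choose_row_sum) (simp add: power_mult)
  finally have "((2 * m + 1) choose m) + ((2 * m + 1) choose (m + 1)) \<le> 2 * 4 ^ m" by simp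
  moreover have "(2 * m + 1) choose (m + 1) = (2 * m + 1) choose m"
    by (subst binomial_symmetric) auto
  ultimately show ?thesis by linarith
qed

text \<open>Erdos' induction: an even \<open>n > 2\<close> is composite and adds nothing; for
  \<open>n = 2 * m + 1\<close> the primes in \<open>(m + 1, n]\<close> divide
  \<open>n choose m \<le> 4 ^ m\<close>, and the induction hypothesis covers those up to
  \<open>m + 1\<close>.\<close>

lemma chebyshev_theta_le: "(\<Sum>p\<in>primes_le n. ln (real p)) \<le> real n * ln 4"
proof (induction n rule: less_induct)
  case (less n)
  consider "n \<le> 2" | "n > 2" "even n" | m where "n = 2 * m + 1" "m > 0"
    by (metis oddE gr0I less_one linorder_not_le mult_0_right add_0 order_less_le one_le_numeral)
  then show ?case
  proof cases
    case 1
    then have "primes_le n = (if n = 2 then {2} else {})"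
      by (auto dest: prime_ge_2_nat intro: le_antisym)
    moreover have "ln 2 \<le> ln (4 :: real)" "0 < ln (4 :: real)" by auto
    then have "ln 2 \<le> (2 * ln 4 :: real)" by linarith
    ultimately show ?thesis by auto
  next
    case 2
    have "\<not> prime n" using 2 by (auto simp: prime_nat_iff)
    have "primes_le n = primes_le (n - 1)"
      using \<open>\<not> prime n\<close> \<open>n > 2\<close> by (auto simp: le_diff_conv2) (metis le_neq_implies_less less_eq_Suc_le not_less_eq_eq Suc_pred less_le_not_le add_leD2 not_less nat_le_linear)
    then have "(\<Sum>p\<in>primes_le n. ln (real p)) \<le> real (n - 1) * ln 4"
      using less[of "n - 1"] 2 by simp
    also have "\<dots> \<le> real n * ln 4" by (intro mult_right_mono) auto
    finally show ?thesis .
  next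
    case (3 m)
    define A where "A = {p. prime p \<and> m + 1 < p \<and> p \<le> n}"
    have "finite A" by (rule finite_subset[OF _ finite_primes_le[of n]]) (auto simp: A_def)
    \<comment> \<open>Since \<open>n - m = m + 1 < p\<close>, neither factorial in the denominator
      is divisible by \<open>p\<close>.\<close>
    have "p dvd n choose m" if "p \<in> A" for p
    proof -
      have "fact m * fact (n - m) * (n choose m) = fact n"
        using 3 by (intro binomial_fact_lemma) auto
      moreover have "prime p" "p \<le> n" "m < p" "n - m < p" using that 3 by (auto simp: A_def)
      then have "prime p" "p dvd fact n" "\<not> p dvd fact m" "\<not> p dvd fact (n - m)"
        by (simp_all only: prime_dvd_fact_iff not_le)
      ultimately show ?thesis by (metis prime_dvd_mult_iff)
    qed
    then have "\<Prod>A \<le> n choose m"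
      using 3 by (intro prod_primes_le) (auto simp: A_def zero_less_binomial_iff)
    also have "\<dots> \<le> 4 ^ m" using binomial_middle_le 3 by simp
    finally have "real (\<Prod>A) \<le> 4 ^ m" by (metis of_nat_le_iff of_nat_numeral of_nat_power)
    moreover have "0 < real (\<Prod>A)" by (auto simp: A_def prime_gt_0_nat intro!: prod_pos)
    ultimately have "ln (real (\<Prod>A)) \<le> ln (4 ^ m)" by (intro ln_mono) auto
    moreover have "ln (real (\<Prod>A)) = (\<Sum>p\<in>A. ln (real p))"
      using \<open>finite A\<close> by (simp, subst ln_prod) (auto simp: A_def prime_gt_0_nat)
    ultimately have "(\<Sum>p\<in>A. ln (real p)) \<le> real m * ln 4" by (simp add: ln_realpow)
    moreover have "(\<Sum>p\<in>primes_le (m + 1). ln (real p)) \<le> real (m + 1) * ln 4"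
      using 3 by (intro less) auto
    moreover have "primes_le n = primes_le (m + 1) \<union> A" "primes_le (m + 1) \<inter> A = {}"
      using 3 by (auto simp: A_def)
    then have "(\<Sum>p\<in>primes_le n. ln (real p)) = (\<Sum>p\<in>primes_le (m + 1). ln (real p)) + (\<Sum>p\<in>A. ln (real p))"
      using \<open>finite A\<close> finite_primes_le by (simp add: sum.union_disjoint)
    ultimately show ?thesis using 3 by (simp add: algebra_simps)
  qed
qed

section \<open>Mertens-type bounds for the sum of \<open>ln p / p\<close>\<close>

text \<open>As \<open>1 / (p * (p - 1))\<close> is the sum of \<open>1 / p ^ i\<close> over
  \<open>i \<ge> 2\<close>, this measures what the higher prime powers contribute to Legendre's
  formula.\<close>

definition prime_power_excess :: "nat \<Rightarrow> real" where
  "prime_power_excess n = (\<Sum>p\<in>primes_le n. ln (real p) / (real p * (real p - 1)))"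

lemma ln_prime_pos: "p \<in> primes_le n \<Longrightarrow> 0 < ln (real p)"
  by (auto dest: prime_gt_1_nat)

lemma sum_ln_floor_ge:
  "real n * (ln (real (Suc n)) - 1 - prime_power_excess n) \<le> (\<Sum>p\<in>primes_le n. ln (real p) * real (n div p))"
proof -
  have "real n * (ln (real (Suc n)) - 1) \<le> (\<Sum>p\<in>primes_le n. ln (real p) * real (multiplicity p (fact n :: nat)))"
    using ln_fact_ge[of n] by (simp only: ln_fact_eq_sum_primes)
  also have "\<dots> \<le> (\<Sum>p\<in>primes_le n. ln (real p) * (real (n div p) + real n / (real p * (real p - 1))))"
    by (intro sum_mono mult_left_mono multiplicity_fact_le less_imp_le ln_prime_pos) auto
  also have "\<dots> = (\<Sum>p\<in>primes_le n. ln (real p) * real (n div p)) + real n * prime_power_excess n"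
    by (simp add: prime_power_excess_def sum.distrib sum_distrib_left distrib_left mult_ac)
  finally show ?thesis by (simp add: algebra_simps)
qed

lemma sum_ln_div_ge:
  assumes "n > 0"
  shows "ln (real (Suc n)) - 1 - prime_power_excess n \<le> (\<Sum>p\<in>primes_le n. ln (real p) / real p)"
proof -
  have "real n * (ln (real (Suc n)) - 1 - prime_power_excess n) \<le> (\<Sum>p\<in>primes_le n. ln (real p) * real (n div p))"
    by (rule sum_ln_floor_ge)
  also have "\<dots> \<le> (\<Sum>p\<in>primes_le n. ln (real p) * (real n / real p))"
    by (intro sum_mono mult_left_mono of_nat_div_le_of_nat less_imp_le ln_prime_pos)
  also have "\<dots> = real n * (\<Sum>p\<in>primes_le n. ln (real p) / real p)"
    by (simp add: sum_distrib_left mult_ac)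
  finally show ?thesis using assms by simp
qed

lemma real_div_minus_one_le: "real n / real p - 1 \<le> real (n div p)"
  using real_of_int_div3[of "int n" "int p"] by (simp flip: of_nat_div)

text \<open>Legendre's formula bounds the sum of \<open>ln p * (n / p - 1)\<close> by
  \<open>ln (fact n)\<close>; the \<open>- 1\<close> costs the theta sum, which Chebyshev's bound
  controls.\<close>

lemma sum_ln_div_le:
  assumes "n > 0"
  shows "(\<Sum>p\<in>primes_le n. ln (real p) / real p) \<le> ln (real n) - 1 + ln 4 + (1 + ln (real n)) / real n"
proof -
  have "real n * (\<Sum>p\<in>primes_le n. ln (real p) / real p) - (\<Sum>p\<in>primes_le n. ln (real p))
    = (\<Sum>p\<in>primes_le n. ln (real p) * (real n / real p - 1))"
    by (simp add: sum_distrib_left right_diff_distrib sum_subtractf mult_ac)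
  also have "\<dots> \<le> (\<Sum>p\<in>primes_le n. ln (real p) * real (multiplicity p (fact n :: nat)))"
  proof (intro sum_mono mult_left_mono less_imp_le[OF ln_prime_pos])
    fix p assume "p \<in> primes_le n"
    then have "real (n div p) \<le> real (multiplicity p (fact n :: nat))"
      using multiplicity_fact_ge by simp
    then show "real n / real p - 1 \<le> real (multiplicity p (fact n :: nat))"
      using real_div_minus_one_le[of n p] by linarith
  qed
  also have "\<dots> = ln (fact n)" by (rule ln_fact_eq_sum_primes[symmetric])
  also have "\<dots> \<le> real n * ln (real n) - real n + 1 + ln (real n)" using assms by (rule ln_fact_le)
  finally have "real n * (\<Sum>p\<in>primes_le n. ln (real p) / real p) \<le> real n * ln (real n) - real n + 1 + ln (real n) + real n * ln 4"
    using chebyshev_theta_le[of n] by linarith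
  also have "\<dots> = real n * (ln (real n) - 1 + ln 4 + (1 + ln (real n)) / real n)"
    using assms by (simp add: field_simps)
  finally show ?thesis using assms by simp
qed

text \<open>The tail is bounded as if it ran over all integers, by telescoping
  \<open>(ln x + 2) / x\<close>. Keeping the subtracted term at \<open>n\<close> makes the induction
  work.\<close>

lemma prime_power_excess_tail:
  assumes "a \<le> n" "a > 0"
  shows "prime_power_excess n \<le> prime_power_excess a + (ln (real a) + 2) / real a - (ln (real n) + 2) / real n"
  using assms(1)
proof (induction n rule: dec_induct)
  case (step n)
  have n: "n > 0" using step assms by simp
  define t where "t = ln (real (Suc n)) / (real (Suc n) * (real (Suc n) - 1))"
  have "t \<ge> 0" by (simp add: t_def)
  then have "prime_power_excess (Suc n) \<le> prime_power_excess n + t"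
    using finite_primes_le by (simp add: prime_power_excess_def primes_le_Suc t_def del: of_nat_Suc)
  moreover have "t \<le> (ln (real n) + 2) / real n - (ln (real (Suc n)) + 2) / real (Suc n)"
  proof -
    have "2 / (real n * real (Suc n)) - 1 / (real n * real n) \<ge> 0"
    proof -
      have "1 / (real n * real n) \<le> 1 / (real n * (real (Suc n) / 2))"
        using n by (intro divide_left_mono mult_left_mono) auto
      then show ?thesis by simp
    qed
    \<comment> \<open>Here \<open>l\<close> will be \<open>ln (Suc n)\<close>, and
      \<open>l - 1 / x\<close> a lower bound for \<open>ln n\<close>; the last bracket was just
      shown to be nonnegative.\<close>
    moreover have "(l - 1 / x + 2) / x - (l + 2) / (x + 1) = l / ((x + 1) * x) + (2 / (x * (x + 1)) - 1 / (x * x))"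
      if "x > 0" for l x :: real
      using that by (simp add: divide_simps) (simp add: algebra_simps)
    from this[of "real n" "ln (real (Suc n))"] have "(ln (real (Suc n)) - 1 / real n + 2) / real n - (ln (real (Suc n)) + 2) / real (Suc n)
       = t + (2 / (real n * real (Suc n)) - 1 / (real n * real n))"
      using n by (simp add: t_def add.commute)
    moreover have "(ln (real (Suc n)) - 1 / real n + 2) / real n \<le> (ln (real n) + 2) / real n"
      using ln_Suc_le[OF n] by (intro divide_right_mono) auto
    ultimately show ?thesis by linarith
  qed
  ultimately show ?case using step by linarith
qed simp

lemma prime_power_excess_le:
  assumes "a > 0"
  shows "prime_power_excess n \<le> prime_power_excess a + (ln (real a) + 2) / real a"
proof (cases "a \<le> n")
  case True
  have "ln (real n) + 2 \<ge> 0" using ln_ge_zero[of "real n"] True assms by simp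
  then have "(ln (real n) + 2) / real n \<ge> 0" by simp
  then show ?thesis using prime_power_excess_tail[OF True assms] by linarith
next
  case False
  have "prime_power_excess n \<le> prime_power_excess a"
    unfolding prime_power_excess_def using False
    by (intro sum_mono2 finite_primes_le) (auto dest: prime_gt_1_nat intro!: divide_nonneg_nonneg)
  moreover have "(ln (real a) + 2) / real a \<ge> 0" using assms ln_ge_zero[of "real a"] by simp
  ultimately show ?thesis by linarith
qed

section \<open>Summation by parts\<close>

text \<open>For \<open>f p = ln p / p\<close> the weight turns the summand into \<open>1 / p\<close>
  above \<open>a\<close>. Up to \<open>a\<close> the weight is constant, so only partial sums from
  \<open>a\<close> on enter.\<close>

lemma abel_primes:
  fixes f :: "nat \<Rightarrow> real"
  assumes "a \<le> n" "2 \<le> a"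
  shows "(\<Sum>p\<in>primes_le n. f p / ln (real (max p a)))
    = (\<Sum>p\<in>primes_le n. f p) / ln (real n)
      + (\<Sum>j=a..<n. (\<Sum>p\<in>primes_le j. f p) * (1 / ln (real j) - 1 / ln (real (Suc j))))"
  using assms(1)
proof (induction n rule: dec_induct)
  case base
  then show ?case by (auto simp: sum_divide_distrib max_def intro!: sum.cong)
next
  case (step n)
  define s where "s = (\<Sum>p\<in>primes_le n. f p)"
  define t where "t = (if prime (Suc n) then f (Suc n) else 0)"
  have "(\<Sum>p\<in>primes_le (Suc n). f p / ln (real (max p a)))
    = (\<Sum>p\<in>primes_le n. f p / ln (real (max p a))) + t / ln (real (Suc n))"
    using finite_primes_le step by (simp add: primes_le_Suc t_def max_def del: of_nat_Suc)
  moreover have "(\<Sum>p\<in>primes_le (Suc n). f p) = s + t"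
    using finite_primes_le by (simp add: primes_le_Suc t_def s_def)
  ultimately show ?case
    using step by (simp add: s_def[symmetric] algebra_simps add_divide_distrib del: of_nat_Suc)
qed

lemma inverse_ln_diff_nonneg:
  assumes "2 \<le> j"
  shows "0 \<le> 1 / ln (real j) - 1 / ln (real (Suc j))"
  using assms by (simp add: frac_le)

text \<open>The increment of \<open>ln\<close> at \<open>j\<close> is at most \<open>1 / j\<close>,
  which cancels the factor \<open>j\<close>. This absorbs the theta terms, bounded by
  \<open>j * ln 4\<close>, in the partial summation.\<close>

lemma mult_inverse_ln_diff_le:
  assumes "2 \<le> a" "a \<le> j"
  shows "real j * (1 / ln (real j) - 1 / ln (real (Suc j))) \<le> 1 / (ln (real a))\<^sup>2"
proof -
  have pos: "0 < ln (real a)" "0 < ln (real j)" "0 < ln (real (Suc j))" using assms by auto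
  have le: "ln (real a) \<le> ln (real j)" "ln (real a) \<le> ln (real (Suc j))" using assms by auto
  have "real j * (ln (real (Suc j)) - ln (real j)) \<le> real j * (1 / real j)"
    using ln_Suc_le[of j] assms by (intro mult_left_mono) auto
  then have "real j * (ln (real (Suc j)) - ln (real j)) / (ln (real j) * ln (real (Suc j))) \<le> 1 / (ln (real a) * ln (real a))"
    using assms pos le by (intro frac_le mult_mono) auto
  moreover have "real j * (1 / ln (real j) - 1 / ln (real (Suc j)))
    = real j * (ln (real (Suc j)) - ln (real j)) / (ln (real j) * ln (real (Suc j)))"
    using pos by (simp add: diff_frac_eq del: of_nat_Suc)
  ultimately show ?thesis by (simp add: power2_eq_square)
qed

text \<open>Apply \<open>ln y \<le> y - 1\<close> to the quotient of \<open>ln (Suc j)\<close> by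
  \<open>ln j\<close>. The inverse quotient gives the companion bound in the other direction, with
  the factor \<open>ln j\<close>.\<close>

lemma ln_Suc_mult_inverse_ln_diff_ge:
  assumes "2 \<le> j"
  shows "ln (ln (real (Suc j))) - ln (ln (real j)) \<le> ln (real (Suc j)) * (1 / ln (real j) - 1 / ln (real (Suc j)))"
proof -
  have pos: "0 < ln (real j)" "0 < ln (real (Suc j))" using assms by auto
  have "ln (ln (real (Suc j)) / ln (real j)) \<le> ln (real (Suc j)) / ln (real j) - 1"
    using pos by (intro ln_le_minus_one) auto
  then show ?thesis using pos by (simp add: ln_div right_diff_distrib del: of_nat_Suc)
qed

lemma ln_mult_inverse_ln_diff_le:
  assumes "2 \<le> j"
  shows "ln (real j) * (1 / ln (real j) - 1 / ln (real (Suc j))) \<le> ln (ln (real (Suc j))) - ln (ln (real j))"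
proof -
  have pos: "0 < ln (real j)" "0 < ln (real (Suc j))" using assms by auto
  have "ln (ln (real j) / ln (real (Suc j))) \<le> ln (real j) / ln (real (Suc j)) - 1"
    using pos by (intro ln_le_minus_one) auto
  then show ?thesis using pos by (simp add: ln_div right_diff_distrib del: of_nat_Suc)
qed

text \<open>For \<open>j < n\<close>, replacing \<open>n div p\<close> by \<open>n / p - 1\<close>
  costs at most \<open>j * ln 4\<close> in the partial sum, hence \<open>ln 4 / (ln a)^2\<close> in
  each of the \<open>n - a\<close> steps.\<close>

lemma weighted_floor_sum_ge:
  assumes "2 \<le> a" "a \<le> n" and Q: "\<And>j. prime_power_excess j \<le> Q"
  shows "real n * (1 + ln (ln (real n)) - ln (ln (real a)) - (1 + Q) / ln (real a))
      - real (n - a) * (ln 4 / (ln (real a))\<^sup>2)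
    \<le> (\<Sum>p\<in>primes_le n. ln (real p) * real (n div p) / ln (real (max p a)))"
proof -
  define S where "S j = (\<Sum>p\<in>primes_le j. ln (real p) * real (n div p))" for j
  define D where "D j = 1 / ln (real j) - 1 / ln (real (Suc j))" for j
  have "ln (real n) > 0" using assms by simp
  \<comment> \<open>The boundary term at \<open>n\<close> uses Legendre's formula with the floors
    kept, so no theta term is lost there.\<close>
  have "real n * (ln (real n) - (1 + Q)) \<le> real n * (ln (real (Suc n)) - 1 - prime_power_excess n)"
    using Q[of n] assms by (intro mult_left_mono) (auto simp: algebra_simps intro: add_mono)
  also have "\<dots> \<le> S n" unfolding S_def by (rule sum_ln_floor_ge)
  finally have "real n * (ln (real n) - (1 + Q)) / ln (real n) \<le> S n / ln (real n)"
    using \<open>ln (real n) > 0\<close> by (intro divide_right_mono) auto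
  then have last: "real n * (1 - (1 + Q) / ln (real n)) \<le> S n / ln (real n)"
    using \<open>ln (real n) > 0\<close> by (simp add: right_diff_distrib diff_divide_distrib)
  \<comment> \<open>A potential whose increments are the main terms of the summands; its
    \<open>1 / ln n\<close> part cancels against the one in \<open>last\<close>.\<close>
  define U where "U j = real n * (ln (ln (real j)) + (1 + Q) / ln (real j))" for j
  have step: "U (Suc j) - U j - ln 4 / (ln (real a))\<^sup>2 \<le> S j * D j"
    if j: "a \<le> j" for j
  proof -
    have "j \<ge> 2" using j assms by simp
    have D: "0 \<le> D j" using inverse_ln_diff_nonneg[OF \<open>j \<ge> 2\<close>] by (simp add: D_def)
    have "real n * (\<Sum>p\<in>primes_le j. ln (real p) / real p) - (\<Sum>p\<in>primes_le j. ln (real p))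
      = (\<Sum>p\<in>primes_le j. ln (real p) * (real n / real p - 1))"
      by (simp add: sum_distrib_left right_diff_distrib sum_subtractf mult_ac)
    also have "\<dots> \<le> S j"
      unfolding S_def by (intro sum_mono mult_left_mono real_div_minus_one_le less_imp_le[OF ln_prime_pos])
    finally have "real n * (\<Sum>p\<in>primes_le j. ln (real p) / real p) - real j * ln 4 \<le> S j"
      using chebyshev_theta_le[of j] by linarith
    moreover have "ln (real (Suc j)) - (1 + Q) \<le> (\<Sum>p\<in>primes_le j. ln (real p) / real p)"
      using sum_ln_div_ge[of j] Q[of j] \<open>j \<ge> 2\<close> by linarith
    then have "real n * (ln (real (Suc j)) - (1 + Q)) \<le> real n * (\<Sum>p\<in>primes_le j. ln (real p) / real p)"
      by (intro mult_left_mono) auto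
    ultimately have "real n * (ln (real (Suc j)) - (1 + Q)) - real j * ln 4 \<le> S j" by linarith
    then have "(real n * (ln (real (Suc j)) - (1 + Q)) - real j * ln 4) * D j \<le> S j * D j"
      using D by (intro mult_right_mono)
    moreover have "(real n * (ln (real (Suc j)) - (1 + Q)) - real j * ln 4) * D j
      = real n * (ln (real (Suc j)) * D j) - real n * ((1 + Q) * D j) - ln 4 * (real j * D j)"
      by (simp add: algebra_simps)
    moreover have "real n * (ln (ln (real (Suc j))) - ln (ln (real j))) \<le> real n * (ln (real (Suc j)) * D j)"
      unfolding D_def by (intro mult_left_mono ln_Suc_mult_inverse_ln_diff_ge \<open>j \<ge> 2\<close>) auto
    moreover have "ln 4 * (real j * D j) \<le> ln 4 * (1 / (ln (real a))\<^sup>2)"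
      unfolding D_def by (intro mult_left_mono mult_inverse_ln_diff_le assms j) auto
    moreover have "U (Suc j) - U j = real n * (ln (ln (real (Suc j))) - ln (ln (real j))) - real n * ((1 + Q) * D j)"
      by (simp add: U_def D_def algebra_simps del: of_nat_Suc)
    ultimately show ?thesis by simp
  qed
  have "(\<Sum>j=a..<n. U (Suc j) - U j - ln 4 / (ln (real a))\<^sup>2) \<le> (\<Sum>j=a..<n. S j * D j)"
    by (intro sum_mono step) auto
  moreover have "(\<Sum>j=a..<n. U (Suc j) - U j - ln 4 / (ln (real a))\<^sup>2)
    = U n - U a - real (n - a) * (ln 4 / (ln (real a))\<^sup>2)"
    using sum_Suc_diff'[OF \<open>a \<le> n\<close>, of U] by (simp add: sum_subtractf)
  ultimately have "real n * (1 - (1 + Q) / ln (real n)) + (U n - U a - real (n - a) * (ln 4 / (ln (real a))\<^sup>2))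
    \<le> S n / ln (real n) + (\<Sum>j=a..<n. S j * D j)"
    using last by linarith
  also have "\<dots> = (\<Sum>p\<in>primes_le n. ln (real p) * real (n div p) / ln (real (max p a)))"
    unfolding S_def D_def using assms by (intro abel_primes[symmetric])
  finally show ?thesis by (simp add: U_def algebra_simps)
qed

text \<open>The same telescoping for an upper bound. Without floors no error accumulates over
  \<open>j\<close>.\<close>

lemma weighted_reciprocal_sum_le:
  assumes "2 \<le> a" "a \<le> n"
    and C: "\<And>j. a \<le> j \<Longrightarrow> (\<Sum>p\<in>primes_le j. ln (real p) / real p) \<le> ln (real j) + C"
  shows "(\<Sum>p\<in>primes_le n. ln (real p) / real p / ln (real (max p a)))
    \<le> 1 + ln (ln (real n)) - ln (ln (real a)) + C / ln (real a)"
proof -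
  define S where "S j = (\<Sum>p\<in>primes_le j. ln (real p) / real p)" for j
  define D where "D j = 1 / ln (real j) - 1 / ln (real (Suc j))" for j
  have "ln (real n) > 0" using assms by simp
  have "S n / ln (real n) \<le> (ln (real n) + C) / ln (real n)"
    unfolding S_def using C assms \<open>ln (real n) > 0\<close> by (intro divide_right_mono) auto
  then have last: "S n / ln (real n) \<le> 1 + C / ln (real n)"
    using \<open>ln (real n) > 0\<close> by (simp add: add_divide_distrib)
  define U where "U j = ln (ln (real j)) - C / ln (real j)" for j
  have step: "S j * D j \<le> U (Suc j) - U j" if j: "a \<le> j" for j
  proof -
    have "j \<ge> 2" using j assms by simp
    have D: "0 \<le> D j" using inverse_ln_diff_nonneg[OF \<open>j \<ge> 2\<close>] by (simp add: D_def)
    have "S j * D j \<le> (ln (real j) + C) * D j"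
      unfolding S_def using C j D by (intro mult_right_mono) auto
    moreover have "ln (real j) * D j \<le> ln (ln (real (Suc j))) - ln (ln (real j))"
      unfolding D_def by (rule ln_mult_inverse_ln_diff_le[OF \<open>j \<ge> 2\<close>])
    moreover have "U (Suc j) - U j = ln (ln (real (Suc j))) - ln (ln (real j)) + C * D j"
      by (simp add: U_def D_def algebra_simps del: of_nat_Suc)
    ultimately show ?thesis by (simp add: distrib_right)
  qed
  have "(\<Sum>p\<in>primes_le n. ln (real p) / real p / ln (real (max p a)))
     = S n / ln (real n) + (\<Sum>j=a..<n. S j * D j)"
    unfolding S_def D_def using assms by (intro abel_primes)
  also have "\<dots> \<le> 1 + C / ln (real n) + (\<Sum>j=a..<n. U (Suc j) - U j)"
    using last by (intro add_mono sum_mono step) auto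
  also have "(\<Sum>j=a..<n. U (Suc j) - U j) = U n - U a" using assms by (simp add: sum_Suc_diff')
  finally show ?thesis by (simp add: U_def)
qed

section \<open>Verified computation with small primes\<close>

text \<open>A literal list, so that the evaluations below need not rerun the sieve.\<close>

definition small_primes :: "int list" where
  "small_primes = [2, 3, 5, 7, 11, 13, 17, 19, 23, 29, 31, 37, 41, 43, 47, 53, 59, 61, 67, 71, 73, 79, 83,
89, 97, 101, 103, 107, 109, 113, 127, 131, 137, 139, 149, 151, 157, 163, 167, 173, 179,
181, 191, 193, 197, 199, 211, 223, 227, 229, 233, 239, 241, 251, 257, 263, 269, 271, 277,
281, 283, 293, 307, 311, 313, 317, 331, 337, 347, 349, 353, 359, 367, 373, 379, 383, 389,
397, 401, 409, 419, 421, 431, 433, 439, 443, 449, 457, 461, 463, 467, 479, 487, 491, 499,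
503, 509, 521, 523, 541, 547, 557, 563, 569, 571, 577, 587, 593, 599, 601, 607, 613, 617,
619, 631, 641, 643, 647, 653, 659, 661, 673, 677, 683, 691, 701, 709, 719, 727, 733, 739,
743, 751, 757, 761, 769, 773, 787, 797, 809, 811, 821, 823, 827, 829, 839, 853, 857, 859,
863, 877, 881, 883, 887, 907, 911, 919, 929, 937, 941, 947, 953, 967, 971, 977, 983, 991,
997, 1009, 1013, 1019, 1021]"

lemma small_primes_sieve:
  "small_primes = filter (\<lambda>m. list_all (\<lambda>d. m \<le> d \<or> m mod d \<noteq> 0) [2,3,5,7,11,13,17,19,23,29,31]) [2..1024]"
  by code_simp

text \<open>The least divisor \<open>q > 1\<close> of a composite \<open>m\<close> is prime and
  satisfies \<open>q * q \<le> m < 37 * 37\<close>.\<close>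

lemma small_prime_divisor:
  fixes m :: nat
  assumes "\<not> prime m" "2 \<le> m" "m < 1369"
  shows "\<exists>d\<in>{2,3,5,7,11,13,17,19,23,29,31}. d < m \<and> d dvd m"
proof -
  define q where "q = (LEAST q. 1 < q \<and> q dvd m)"
  have ex: "1 < m \<and> m dvd m" using assms by simp
  have q: "1 < q" "q dvd m" using LeastI[of "\<lambda>q. 1 < q \<and> q dvd m", OF ex] by (auto simp: q_def)
  have qmin: "q \<le> r" if "1 < r" "r dvd m" for r
    using that unfolding q_def by (intro Least_le) auto
  have "prime q"
    by (metis q qmin prime_factor_nat dvd_trans prime_gt_1_nat dvd_imp_le le_antisym less_numeral_extra(4) not_less0 neq0_conv order_less_le)
  have "q \<noteq> m" using \<open>prime q\<close> assms by auto
  obtain r where r: "m = q * r" using q by auto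
  have "r > 1" using r \<open>q \<noteq> m\<close> assms by (cases r; cases "r - 1") auto
  then have "q \<le> r" using qmin r by auto
  then have "q * q \<le> m" using r by simp
  then have "q * q < 37 * 37" using assms by simp
  then have "q < 37" by (meson mult_le_mono not_less)
  have "q < m" using r \<open>r > 1\<close> q by auto
  have "q \<in> {2..<37}" using \<open>q < 37\<close> q by auto
  \<comment> \<open>Every composite number below 37 is a proper multiple of 2, 3 or 5.\<close>
  then have "q \<in> {2,3,5,7,11,13,17,19,23,29,31} \<or> (\<exists>s\<in>{2,3,5}. s < q \<and> s dvd q)"
    by (simp add: atLeastLessThan_nat_numeral numeral_eq_Suc atLeastLessThanSuc dvd_def) presburger
  moreover have "\<not> (s < q \<and> s dvd q)" if "s \<in> {2,3,5}" for s
    using that \<open>prime q\<close> by (auto simp: prime_nat_iff)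
  ultimately show ?thesis using \<open>q < m\<close> q by blast
qed

lemma set_small_primes: "set small_primes = int ` primes_le 1024"
proof -
  have prime_iff: "prime m \<longleftrightarrow> (\<forall>d\<in>{2,3,5,7,11,13,17,19,23,29,31}. m \<le> d \<or> m mod d \<noteq> 0)"
    if "2 \<le> m" "m \<le> 1024" for m :: nat
  proof
    assume "prime m"
    show "\<forall>d\<in>{2,3,5,7,11,13,17,19,23,29,31}. m \<le> d \<or> m mod d \<noteq> 0"
    proof (intro ballI)
      fix d assume "d \<in> {2,3,5,7,11,13,17,19,23,29,31::nat}"
      then have "d \<noteq> 1" by auto
      then show "m \<le> d \<or> m mod d \<noteq> 0"
        using \<open>prime m\<close> by (auto simp: prime_nat_iff mod_eq_0_iff_dvd)
    qed
  next
    assume *: "\<forall>d\<in>{2,3,5,7,11,13,17,19,23,29,31}. m \<le> d \<or> m mod d \<noteq> 0"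
    show "prime m"
    proof (rule ccontr)
      assume "\<not> prime m"
      then have "\<exists>d\<in>{2,3,5,7,11,13,17,19,23,29,31}. d < m \<and> d dvd m"
        using that by (intro small_prime_divisor) auto
      then obtain d where "d \<in> {2,3,5,7,11,13,17,19,23,29,31}" "d < m" "d dvd m" by blast
      with * show False by (meson dvd_imp_mod_0 leD)
    qed
  qed
  have eq: "prime m \<longleftrightarrow> list_all (\<lambda>d. int m \<le> d \<or> int m mod d \<noteq> 0) [2,3,5,7,11,13,17,19,23,29,31]"
    if "2 \<le> m" "m \<le> 1024" for m
  proof -
    have "int m \<le> numeral d \<longleftrightarrow> m \<le> numeral d" "int m mod numeral d = 0 \<longleftrightarrow> m mod numeral d = 0" for d
      using zmod_int[of m "numeral d"] by auto
    then show ?thesis using prime_iff[OF that] by simp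
  qed
  have set: "set small_primes = {m\<in>{2..1024}. list_all (\<lambda>d. m \<le> d \<or> m mod d \<noteq> 0) [2,3,5,7,11,13,17,19,23,29,31]}"
    by (simp only: small_primes_sieve set_filter set_upto)
  show ?thesis
  proof (intro equalityI subsetI)
    fix x assume x: "x \<in> set small_primes"
    then have *: "x \<in> {2..1024}"
      "list_all (\<lambda>d. x \<le> d \<or> x mod d \<noteq> 0) [2,3,5,7,11,13,17,19,23,29,31]"
      unfolding set by (simp_all only: mem_Collect_eq)
    from *(1) have "2 \<le> nat x" "nat x \<le> 1024" "x = int (nat x)" by auto
    with *(2) eq[of "nat x"] have "prime (nat x)" by (simp only: simp_thms)
    with \<open>nat x \<le> 1024\<close> have "nat x \<in> primes_le 1024" by simp
    then show "x \<in> int ` primes_le 1024" using \<open>x = int (nat x)\<close> by blast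
  next
    fix x assume "x \<in> int ` primes_le 1024"
    then obtain m where m: "x = int m" "prime m" "m \<le> 1024" by auto
    then have "m \<ge> 2" using prime_ge_2_nat by blast
    then have "x \<in> {2..1024}" using m by auto
    then show "x \<in> set small_primes"
      unfolding set using m \<open>m \<ge> 2\<close> eq[of m] by (simp only: mem_Collect_eq simp_thms)
  qed
qed

lemma distinct_small_primes: "distinct small_primes"
  unfolding small_primes_sieve by (intro distinct_filter distinct_upto)

text \<open>
  Fixed-point numbers with scale \<open>2^20\<close>: for \<open>1 \<le> x / 2^20 < 2\<close> the first \<open>d\<close> binary digits of the
  logarithm are found by repeated squaring, rounding up after each step; the result has scale \<open>2^d\<close>.
\<close>

primrec log2_ub :: "nat \<Rightarrow> int \<Rightarrow> int" where
  "log2_ub 0 x = 1"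
| "log2_ub (Suc d) x = (let y = x * x div 1048576 + 1 in
     if y < 2097152 then log2_ub d y else 2 ^ d + log2_ub d (y div 2 + 1))"

lemma log2_ub:
  assumes "0 < x" "x < 2097152"
  shows "log 2 (real_of_int x / 1048576) \<le> real_of_int (log2_ub d x) / 2 ^ d"
  using assms
proof (induction d arbitrary: x)
  case 0
  \<comment> \<open>The remaining mantissa is below 2, so its logarithm is at most the value
    \<open>1\<close> at depth 0.\<close>
  have "log 2 (real_of_int x / 1048576) \<le> log 2 2"
    using 0 by (subst log_le_cancel_iff) auto
  then show ?case by simp
next
  case (Suc d)
  define y where "y = x * x div 1048576 + 1"
  have "x * x \<ge> 0" by simp
  then have ypos: "y > 0" by (simp add: y_def pos_imp_zdiv_nonneg_iff)
  have "t \<le> 1048576 * (t div 1048576 + 1)" for t :: int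
    using mult_div_mod_eq[of 1048576 t] pos_mod_bound[of 1048576 t] by (simp add: distrib_left)
  then have "x * x \<le> 1048576 * y" unfolding y_def .
  then have "real_of_int (x * x) \<le> real_of_int (1048576 * y)" by (simp only: of_int_le_iff)
  then have sq: "(real_of_int x / 1048576)\<^sup>2 \<le> real_of_int y / 1048576"
    by (simp add: power2_eq_square field_simps)
  have "2 * log 2 (real_of_int x / 1048576) = log 2 ((real_of_int x / 1048576)\<^sup>2)"
    using Suc.prems by (subst log_nat_power) auto
  also have "\<dots> \<le> log 2 (real_of_int y / 1048576)"
    using sq Suc.prems ypos by (subst log_le_cancel_iff) auto
  finally have *: "2 * log 2 (real_of_int x / 1048576) \<le> log 2 (real_of_int y / 1048576)" .
  have step: "log2_ub (Suc d) x = (if y < 2097152 then log2_ub d y else 2 ^ d + log2_ub d (y div 2 + 1))"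
    by (simp add: y_def Let_def)
  show ?case
  proof (cases "y < 2097152")
    case True
    have "2 * log 2 (real_of_int x / 1048576) \<le> real_of_int (log2_ub d y) / 2 ^ d"
      using Suc.IH[OF ypos True] * by linarith
    then show ?thesis unfolding step using True by simp
  next
    case False
    \<comment> \<open>Keeps the halved mantissa below \<open>2097152\<close> in spite of the two
      upward roundings.\<close>
    have ub: "x * x \<le> 2097151 * 2097151" using Suc.prems by (intro mult_mono) auto
    have "y div 2 + 1 > 0" using ypos by linarith
    moreover have "y div 2 + 1 < 2097152"
    proof -
      have "y \<le> 4194301" using zdiv_mono1[OF ub, of 1048576] by (simp add: y_def)
      then show ?thesis by linarith
    qed
    ultimately have IH: "log 2 (real_of_int (y div 2 + 1) / 1048576) \<le> real_of_int (log2_ub d (y div 2 + 1)) / 2 ^ d"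
      by (rule Suc.IH)
    have "y \<le> 2 * (y div 2 + 1)" by presburger
    then have "real_of_int y \<le> real_of_int (2 * (y div 2 + 1))" by (simp only: of_int_le_iff)
    then have "real_of_int y \<le> 2 * real_of_int (y div 2 + 1)" by simp
    then have "log 2 (real_of_int y / 1048576) \<le> log 2 (2 * (real_of_int (y div 2 + 1) / 1048576))"
      using ypos by (subst log_le_cancel_iff) auto
    also have "\<dots> = 1 + log 2 (real_of_int (y div 2 + 1) / 1048576)"
      using ypos by (subst log_mult) auto
    finally have "2 * log 2 (real_of_int x / 1048576) \<le> 1 + real_of_int (log2_ub d (y div 2 + 1)) / 2 ^ d"
      using IH * by linarith
    then show ?thesis unfolding step using False by (simp add: add_divide_distrib)
  qed
qed

section \<open>Binary logarithms of integers\<close>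

text \<open>The integer part of the binary logarithm of \<open>n\<close>, for
  \<open>1 \<le> n < 2 ^ Suc j\<close>.\<close>

primrec dyad :: "nat \<Rightarrow> int \<Rightarrow> nat" where
  "dyad 0 n = 0"
| "dyad (Suc j) n = (if n < 2 ^ Suc j then dyad j n else Suc j)"

lemma dyad_less: "n < 2 ^ Suc j \<Longrightarrow> n < 2 ^ Suc (dyad j n)"
  by (induction j) auto

lemma dyad_le: "dyad j n \<le> j"
  by (induction j) (auto intro: le_SucI)

text \<open>An upper bound for \<open>4096 * log 2 n\<close>: the mantissa \<open>n / 2 ^ k\<close>
  is passed on at scale \<open>2^20\<close> for 12 fractional digits.\<close>

definition log2_scaled :: "int \<Rightarrow> int" where
  "log2_scaled n = (let k = dyad 10 n in 4096 * int k + log2_ub 12 (n * 2 ^ (20 - k)))"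

lemma log2_scaled:
  assumes "0 < n" "n < 2048"
  shows "log 2 (real_of_int n) \<le> real_of_int (log2_scaled n) / 4096"
proof -
  define k where "k = dyad 10 n"
  have "n < 2 ^ Suc k" using dyad_less[of n 10] assms by (simp add: k_def)
  moreover have "k \<le> 10" using dyad_le by (simp add: k_def)
  ultimately have "n * 2 ^ (20 - k) < 2 ^ Suc k * 2 ^ (20 - k)"
    by (intro mult_strict_right_mono) auto
  also have "(2::int) ^ Suc k * 2 ^ (20 - k) = 2097152"
    using \<open>k \<le> 10\<close> by (subst power_add[symmetric]) (simp add: Suc_diff_le)
  finally have "n * 2 ^ (20 - k) < 2097152" .
  then have "log 2 (real_of_int (n * 2 ^ (20 - k)) / 1048576) \<le> real_of_int (log2_ub 12 (n * 2 ^ (20 - k))) / 2 ^ 12"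
    using assms by (intro log2_ub) auto
  moreover have "(2::real) ^ (20 - k) = 1048576 / 2 ^ k"
    using \<open>k \<le> 10\<close> by (subst power_diff) auto
  then have "real_of_int (n * 2 ^ (20 - k)) / 1048576 = real_of_int n / 2 ^ k"
    by (simp only: of_int_mult of_int_power of_int_numeral) simp
  moreover have "log 2 (real_of_int n / 2 ^ k) = log 2 (real_of_int n) - k"
    using assms by (subst log_divide) (auto simp: log_nat_power)
  ultimately have "log 2 (real_of_int n) - k \<le> real_of_int (log2_ub 12 (n * 2 ^ (20 - k))) / 4096"
    by simp
  then show ?thesis by (simp add: log2_scaled_def k_def[symmetric] Let_def add_divide_distrib)
qed

section \<open>Integer checks for the lower bound\<close>

fun floor_sum :: "int \<Rightarrow> int list \<Rightarrow> int" where
  "floor_sum n [] = 0"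
| "floor_sum n (p # ps) = (if n < p then 0 else n div p + floor_sum n ps)"

text \<open>Stopping at the first entry above \<open>n\<close> only drops nonnegative terms.\<close>

lemma floor_sum_le:
  assumes "0 \<le> n" "\<And>p. p \<in> set ps \<Longrightarrow> 0 < p"
  shows "floor_sum n ps \<le> sum_list (map (\<lambda>p. n div p) ps)"
proof -
  have "0 \<le> sum_list (map (\<lambda>p. n div p) ps)" if "\<And>p. p \<in> set ps \<Longrightarrow> 0 < p" for ps
    using assms that by (intro sum_list_nonneg) (auto simp: pos_imp_zdiv_nonneg_iff)
  with assms show ?thesis by (induction ps) (auto simp: pos_imp_zdiv_nonneg_iff)
qed

text \<open>
  Bounds \<open>n (45/32 + ln (ln n / ln 32))\<close> for \<open>n \<in> {a..b}\<close> by its value at \<open>b\<close>, and the prime sum at \<open>n\<close> by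
  the one at \<open>a\<close>. The number \<open>x\<close> approximates \<open>log2 b / 5 = ln b / ln 32\<close>, and \<open>4615/6658\<close> is an upper bound for \<open>ln 2\<close>.
\<close>

definition good_interval :: "int \<Rightarrow> int \<Rightarrow> bool" where
  "good_interval a b \<longleftrightarrow> 0 < a \<and> b < 2048 \<and>
    (let x = log2_scaled b * 256 div 5 + 1 in x < 2097152 \<and>
     4615 * 32 * b * log2_ub 12 x < 6658 * 4096 * (32 * floor_sum a small_primes - 45 * b))"

fun good_cover :: "int list \<Rightarrow> bool" where
  "good_cover (a # b # xs) \<longleftrightarrow> good_interval a (b - 1) \<and> good_cover (b # xs)"
| "good_cover _ \<longleftrightarrow> True"

lemma good_coverD:
  assumes "good_cover xs" "xs \<noteq> []" "hd xs \<le> n" "n < last xs"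
  shows "\<exists>a b. good_interval a b \<and> a \<le> n \<and> n \<le> b"
  using assms
proof (induction xs rule: good_cover.induct)
  case (1 a b xs)
  show ?case
  proof (cases "n < b")
    case True
    with 1 show ?thesis by (intro exI[of _ a] exI[of _ "b - 1"]) auto
  next
    case False
    with 1 show ?thesis by auto
  qed
qed auto

text \<open>Concerns \<open>1 / p - L / (p - 1)\<close>, where
  \<open>L = log2_scaled p / 40960\<close> bounds \<open>ln p / ln 1024\<close> from above, scaled
  by \<open>40960 * 10^6\<close>. The \<open>- 1\<close> makes up for rounding down the subtracted
  quotient.\<close>

lemma log_sum_small_primes:
  "1279800 * 40960 \<le> sum_list (map (\<lambda>p. 40960000000 div p - (1000000 * log2_scaled p) div (p - 1) - 1) small_primes)"
  by code_simp

text \<open>The scaled sum of \<open>1 - L\<close>: the additive loss from replacing floors by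
  \<open>n / p - 1\<close> at the small primes.\<close>

lemma coeff_sum_small_primes:
  "100 * sum_list (map (\<lambda>p. 40960 - log2_scaled p) small_primes) \<le> 3006 * 40960"
  by code_simp

text \<open>Ensures \<open>L \<le> 1\<close>, so that the coefficients \<open>1 - L\<close> are
  nonnegative.\<close>

lemma log2_scaled_small_primes:
  "list_all (\<lambda>p. log2_scaled p \<le> 40960) small_primes"
  by code_simp

text \<open>The breakpoints are dense for small \<open>n\<close>, where the bound is nearly
  attained, and farther apart later.\<close>

lemma good_cover_33_1024: "good_cover [33, 34, 35, 36, 37, 38, 39, 40, 41, 42, 44, 45, 46, 47, 48, 49, 50, 51, 52, 53, 54, 55,
56, 57, 58, 59, 60, 61, 62, 63, 64, 65, 66, 67, 68, 69, 70, 72, 73, 74, 75, 76, 77, 78,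
80, 81, 82, 83, 84, 85, 86, 87, 88, 89, 90, 92, 94, 96, 98, 99, 100, 102, 104, 105, 107,
108, 109, 110, 111, 112, 114, 116, 118, 120, 122, 124, 126, 128, 129, 130, 132, 134, 136,
138, 140, 142, 144, 146, 148, 150, 152, 153, 154, 156, 158, 160, 162, 164, 166, 168, 170,
172, 174, 176, 178, 180, 182, 184, 186, 189, 191, 193, 195, 197, 199, 201, 203, 205, 207,
209, 211, 214, 217, 220, 223, 226, 229, 231, 234, 237, 240, 244, 247, 250, 253, 256, 259,
262, 265, 268, 271, 274, 277, 280, 283, 286, 290, 294, 297, 300, 304, 308, 312, 316, 320,
324, 328, 332, 336, 341, 345, 350, 354, 358, 362, 366, 370, 374, 379, 383, 387, 391, 396,
401, 405, 409, 413, 418, 423, 428, 433, 438, 444, 450, 456, 462, 468, 474, 480, 486, 493,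
499, 506, 512, 518, 525, 532, 539, 546, 553, 560, 568, 575, 583, 591, 599, 607, 614, 622,
630, 639, 647, 655, 663, 672, 682, 691, 700, 710, 720, 730, 740, 750, 760, 770, 780, 791,
802, 813, 824, 835, 847, 858, 870, 882, 894, 906, 919, 932, 945, 958, 972, 986, 1000,
1014, 1024]"
  by code_simp

section \<open>The bounds\<close>

text \<open>Three terms of the series for \<open>2 * artanh (1 / 3)\<close> with its remainder
  bound.\<close>

lemma ln_2_bounds: "ln (2 :: real) \<in> {307 / 443..4615 / 6658}"
proof -
  have "(\<Sum>k<3. 2 * ((2 - 1) / (2 + 1)) ^ (2 * k + 1) / real (2 * k + 1)) = (842 / 1215 :: real)"
    by (subst numeral_3_eq_3) (simp add: power_divide)
  with ln_approx_bounds[of 2 3] show ?thesis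
    by (simp add: power_divide)
qed

lemma ln_2_ge: "693 / 1000 \<le> ln (2 :: real)" and ln_2_le: "ln (2 :: real) \<le> 4615 / 6658"
  using ln_2_bounds by simp_all

lemma sum_primes_le_mono_neutral:
  assumes "n \<le> m"
  shows "(\<Sum>p\<in>primes_le n. real (n div p)) = (\<Sum>p\<in>primes_le m. real (n div p))"
proof (intro sum.mono_neutral_left finite_primes_le ballI)
  fix p assume "p \<in> primes_le m - primes_le n"
  then have "n < p" by auto
  then show "real (n div p) = 0" by simp
qed (use assms in auto)

lemma sum_small_primes:
  "(\<Sum>p\<in>primes_le 1024. f (int p)) = sum_list (map f small_primes)"
proof -
  have "sum_list (map f small_primes) = (\<Sum>p\<in>int ` primes_le 1024. f p)"
    by (simp add: sum_list_distinct_conv_sum_set distinct_small_primes set_small_primes)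
  then show ?thesis by (simp add: sum.reindex)
qed

lemma ln_powers_of_2:
  "ln (4 :: real) = 2 * ln 2" "ln (32 :: real) = 5 * ln 2" "ln (1024 :: real) = 10 * ln 2"
  using ln_realpow[of 2 2] ln_realpow[of 2 5] ln_realpow[of 2 10] by simp_all

text \<open>The first term of the series for \<open>2 * artanh y\<close> at
  \<open>y = (x - 1) / (x + 1)\<close>.\<close>

lemma ln_ge_rational: "2 * (x - 1) / (x + 1) \<le> ln x" if "1 < x" for x :: real
  using ln_approx_bounds[of x 1] that by simp

lemma small_prime_bounds:
  assumes "p \<in> primes_le 1024"
  shows "ln (real p) \<le> real_of_int (log2_scaled (int p)) / 4096 * ln 2" "log2_scaled (int p) \<le> 40960"
proof -
  have "p > 0" using assms by (auto intro: prime_gt_0_nat)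
  then have "log 2 (real_of_int (int p)) \<le> real_of_int (log2_scaled (int p)) / 4096"
    using assms by (intro log2_scaled) auto
  then show "ln (real p) \<le> real_of_int (log2_scaled (int p)) / 4096 * ln 2"
    by (simp add: log_def pos_divide_le_eq)
  have "int p \<in> set small_primes" unfolding set_small_primes using assms by blast
  then show "log2_scaled (int p) \<le> 40960"
    using log2_scaled_small_primes by (simp add: list_all_iff)
qed

lemma main_sum_bound:
  "12798 / 10000 \<le> (\<Sum>p\<in>primes_le 1024. 1 / real p - real_of_int (log2_scaled (int p)) / 40960 / (real p - 1))"
proof -
  let ?f = "\<lambda>p. 40960000000 div p - (1000000 * log2_scaled p) div (p - 1) - 1"
  have "real_of_int (1279800 * 40960) \<le> real_of_int (sum_list (map ?f small_primes))"
    using log_sum_small_primes by (simp only: of_int_le_iff)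
  also have "\<dots> = (\<Sum>p\<in>primes_le 1024. real_of_int (?f (int p)))"
    by (simp only: sum_small_primes[symmetric] of_int_sum)
  also have "\<dots> \<le> (\<Sum>p\<in>primes_le 1024. 40960000000 * (1 / real p - real_of_int (log2_scaled (int p)) / 40960 / (real p - 1)))"
  proof (intro sum_mono)
    fix p
    have "real_of_int (40960000000 div int p) \<le> 40960000000 / real p"
      using real_of_int_div4[of 40960000000 "int p"] by simp
    moreover have "1000000 * real_of_int (log2_scaled (int p)) / (real p - 1) - 1
      \<le> real_of_int ((1000000 * log2_scaled (int p)) div (int p - 1))"
      using real_of_int_div3[of "1000000 * log2_scaled (int p)" "int p - 1"] by simp
    moreover have "40960000000 * (1 / x - l / 40960 / q) = 40960000000 / x - 1000000 * l / q" for x q l :: real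
      by (simp add: right_diff_distrib)
    note this[of "real p" "real_of_int (log2_scaled (int p))" "real p - 1"]
    ultimately show "real_of_int (?f (int p))
      \<le> 40960000000 * (1 / real p - real_of_int (log2_scaled (int p)) / 40960 / (real p - 1))"
      by simp
  qed
  also have "\<dots> = 40960000000 * (\<Sum>p\<in>primes_le 1024. 1 / real p - real_of_int (log2_scaled (int p)) / 40960 / (real p - 1))"
    by (rule sum_distrib_left[symmetric])
  finally show ?thesis by simp
qed

lemma coeff_sum_bound:
  "(\<Sum>p\<in>primes_le 1024. 1 - real_of_int (log2_scaled (int p)) / 40960) \<le> 3006 / 100"
proof -
  have "real_of_int (100 * sum_list (map (\<lambda>p. 40960 - log2_scaled p) small_primes)) \<le> real_of_int (3006 * 40960)"
    using coeff_sum_small_primes by (simp only: of_int_le_iff)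
  then have "real_of_int 100 * (\<Sum>p\<in>primes_le 1024. real_of_int (40960 - log2_scaled (int p))) \<le> real_of_int (3006 * 40960)"
    by (simp only: sum_small_primes[symmetric] of_int_sum of_int_mult)
  moreover have "(\<Sum>p\<in>primes_le 1024. real_of_int (40960 - log2_scaled (int p)))
    = 40960 * (\<Sum>p\<in>primes_le 1024. 1 - real_of_int (log2_scaled (int p)) / 40960)"
    unfolding sum_distrib_left by (intro sum.cong) auto
  ultimately show ?thesis by linarith
qed

text \<open>The final budget: \<open>E\<close> cancels, and per unit of \<open>N\<close> there
  remains \<open>1 + 1.2798 - 0.1456 - 1/34 - 0.69316 > 45/32\<close>. The additive loss 30.06 is
  covered by the gain \<open>1024/34\<close> from \<open>M = N - 1024\<close>.\<close>

lemma lower_bound_large_arith: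
  fixes N :: real
  assumes "S1 + S2 \<le> T" "S2 = S3" "S4 \<le> S3" "S4 = N * R - A" "A \<le> 3006 / 100"
    "N * (12798 / 10000 + E) \<le> N * R" "N * (1 + l - B - K) - M * c \<le> S1"
    "N * K \<le> N * (E + (1 / 1024 + (1 / 10 + 1 / 5120) * (1000 / 693)))"
    "M * c \<le> M * (1 / 34)" "N * (B - C) \<le> N * (69316 / 100000)" "M = N - 1024" "1024 \<le> N"
  shows "N * (45 / 32 + l - C) < T"
proof -
  have "N * R \<ge> N * (12798 / 10000) + N * E" using assms(6) by (simp add: distrib_left)
  moreover have "N + N * l - N * B - N * K - M * c \<le> S1" using assms(7) by (simp add: algebra_simps)
  moreover have "N * K \<le> N * E + N * (1456 / 10000)"
    using assms(8) \<open>1024 \<le> N\<close> by (simp add: distrib_left)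
  moreover have "M * c \<le> N / 34 - 1024 / 34" using assms(9,11) by simp
  moreover have "N * B - N * C \<le> N * (69316 / 100000)" using assms(10) by (simp add: algebra_simps)
  moreover have "N * (45 / 32 + l - C) = N * (45 / 32) + N * l - N * C" by (simp add: algebra_simps)
  ultimately show ?thesis using assms(1-5,12) by linarith
qed

lemma lower_bound_large:
  assumes "n \<ge> 1024"
  shows "real n * (45 / 32 + ln (ln (real n)) - ln (ln 32)) < (\<Sum>p\<in>primes_le n. real (n div p))"
proof -
  define L where "L p = real_of_int (log2_scaled (int p)) / 40960" for p
  \<comment> \<open>Never evaluated: it bounds \<open>prime_power_excess 1024 / ln 1024\<close> from
    above and also splits off from the sum of \<open>(1 - L p) / p\<close>, so that it cancels in
    the end.\<close>
  define E where "E = (\<Sum>p\<in>primes_le 1024. L p / (real p * (real p - 1)))"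
  define Q where "Q = prime_power_excess 1024 + (ln (real 1024) + 2) / real 1024"
  have ln2: "0 < ln (2 :: real)" by simp
  have L: "ln (real p) \<le> L p * ln (real 1024)" "L p \<le> 1" if "p \<in> primes_le 1024" for p
    using small_prime_bounds[OF that] by (auto simp: L_def ln_powers_of_2)
  \<comment> \<open>For \<open>p \<le> 1024\<close> write \<open>1 \<ge> ln p / ln 1024 + (1 - L p)\<close>; the first part joins the weights \<open>1 / ln p\<close> of the
    large primes and is summed by parts, the second is evaluated numerically.\<close>
  have "(\<Sum>p\<in>primes_le n. ln (real p) * real (n div p) / ln (real (max p 1024))
      + (if p \<le> 1024 then (1 - L p) * real (n div p) else 0)) \<le> (\<Sum>p\<in>primes_le n. real (n div p))"
  proof (intro sum_mono)
    fix p assume p: "p \<in> primes_le n"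
    show "ln (real p) * real (n div p) / ln (real (max p 1024))
      + (if p \<le> 1024 then (1 - L p) * real (n div p) else 0) \<le> real (n div p)"
    proof (cases "p \<le> 1024")
      case True
      then have "ln (real p) / ln (real 1024) \<le> L p"
        using L(1)[of p] p ln2 by (simp add: pos_divide_le_eq ln_powers_of_2)
      then have "ln (real p) / ln (real 1024) * real (n div p) \<le> L p * real (n div p)"
        by (intro mult_right_mono) auto
      then show ?thesis using True by (simp add: max_def algebra_simps)
    next
      case False
      then show ?thesis using ln_prime_pos[OF p] by (simp add: max_def)
    qed
  qed
  moreover have "(\<Sum>p\<in>primes_le n. if p \<le> 1024 then (1 - L p) * real (n div p) else 0)
    = (\<Sum>p\<in>primes_le 1024. (1 - L p) * real (n div p))"
  proof -
    have "primes_le n \<inter> {p. p \<le> 1024} = primes_le 1024" using assms by auto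
    then show ?thesis using finite_primes_le by (simp add: sum.If_cases)
  qed
  moreover have "(\<Sum>p\<in>primes_le 1024. (1 - L p) * (real n / real p - 1))
    \<le> (\<Sum>p\<in>primes_le 1024. (1 - L p) * real (n div p))"
    using L(2) by (intro sum_mono mult_left_mono real_div_minus_one_le) auto
  moreover have "(\<Sum>p\<in>primes_le 1024. (1 - L p) * (real n / real p - 1))
    = real n * (\<Sum>p\<in>primes_le 1024. (1 - L p) / real p) - (\<Sum>p\<in>primes_le 1024. 1 - L p)"
    by (simp add: sum_distrib_left right_diff_distrib sum_subtractf mult_ac)
  moreover have "(\<Sum>p\<in>primes_le 1024. 1 - L p) \<le> 3006 / 100"
    using coeff_sum_bound by (simp add: L_def)
  moreover have "(\<Sum>p\<in>primes_le 1024. (1 - L p) / real p) \<ge> 12798 / 10000 + E"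
  proof -
    have "(1 - L p) / real p = (1 / real p - L p / (real p - 1)) + L p / (real p * (real p - 1))"
      if "p \<in> primes_le 1024" for p
    proof -
      have "real p > 1" using that by (auto dest: prime_gt_1_nat)
      then show ?thesis by (simp add: divide_simps) (simp add: algebra_simps)
    qed
    then have "(\<Sum>p\<in>primes_le 1024. (1 - L p) / real p)
      = (\<Sum>p\<in>primes_le 1024. 1 / real p - L p / (real p - 1)) + E"
      by (simp add: E_def sum.distrib)
    then show ?thesis using main_sum_bound by (simp add: L_def)
  qed
  then have "real n * (12798 / 10000 + E) \<le> real n * (\<Sum>p\<in>primes_le 1024. (1 - L p) / real p)"
    by (intro mult_left_mono) auto
  moreover have "real n * (1 + ln (ln (real n)) - ln (ln (real 1024)) - (1 + Q) / ln (real 1024))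
      - real (n - 1024) * (ln 4 / (ln (real 1024))\<^sup>2)
    \<le> (\<Sum>p\<in>primes_le n. ln (real p) * real (n div p) / ln (real (max p 1024)))"
    using assms prime_power_excess_le[of 1024] by (intro weighted_floor_sum_ge) (auto simp: Q_def)
  moreover have "(1 + Q) / ln (real 1024) \<le> E + (1 / 1024 + (1 / 10 + 1 / 5120) * (1000 / 693))"
  proof -
    have "prime_power_excess 1024 \<le> (\<Sum>p\<in>primes_le 1024. ln (real 1024) * (L p / (real p * (real p - 1))))"
      unfolding prime_power_excess_def
    proof (intro sum_mono)
      fix p assume p: "p \<in> primes_le 1024"
      then have "real p > 1" by (auto dest: prime_gt_1_nat)
      then show "ln (real p) / (real p * (real p - 1)) \<le> ln (real 1024) * (L p / (real p * (real p - 1)))"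
        using L(1)[OF p] by (simp add: divide_right_mono mult_ac)
    qed
    then have "prime_power_excess 1024 \<le> ln (real 1024) * E" by (simp add: E_def sum_distrib_left)
    then have "(1 + Q) / ln (real 1024) \<le> (1 + ln (real 1024) * E + (ln (real 1024) + 2) / 1024) / ln (real 1024)"
      unfolding Q_def by (intro divide_right_mono) auto
    \<comment> \<open>The constants are \<open>1 / 10\<close> from the term 1 and
      \<open>2 / 10240\<close> from the tail, both over \<open>ln 2\<close>.\<close>
    also have "\<dots> = E + 1 / 1024 + (1 / 10 + 1 / 5120) * (1 / ln 2)"
      by (simp add: ln_powers_of_2 field_simps)
    also have "1 / ln (2 :: real) \<le> 1000 / 693" using ln_2_ge by (simp add: field_simps)
    finally show ?thesis by simp
  qed
  then have "real n * ((1 + Q) / ln (real 1024)) \<le> real n * (E + (1 / 1024 + (1 / 10 + 1 / 5120) * (1000 / 693)))"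
    by (intro mult_left_mono) auto
  moreover have "real (n - 1024) * (ln 4 / (ln (real 1024))\<^sup>2) \<le> real (n - 1024) * (1 / 34)"
    using ln_2_ge by (intro mult_left_mono) (auto simp: ln_powers_of_2 power2_eq_square field_simps)
  moreover have "real n * (ln (ln (real 1024)) - ln (ln 32)) \<le> real n * (69316 / 100000)"
  proof -
    have "ln (ln (real 1024)) - ln (ln 32) = ln 2"
      using ln_divide_pos[of "10 * ln 2" "5 * ln (2::real)"] by (simp add: ln_powers_of_2)
    then show ?thesis using ln_2_le by (intro mult_left_mono) auto
  qed
  moreover have "real (n - 1024) = real n - 1024" using assms by simp
  moreover have "1024 \<le> real n" using assms by simp
  ultimately show ?thesis unfolding sum.distrib by (rule lower_bound_large_arith)
qed

lemma lower_bound_middle: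
  assumes "33 \<le> n" "n < 1024"
  shows "real n * (45 / 32 + ln (ln (real n)) - ln (ln 32)) < (\<Sum>p\<in>primes_le n. real (n div p))"
proof -
  obtain a b where ab: "good_interval a b" "a \<le> int n" "int n \<le> b"
    using good_coverD[OF good_cover_33_1024, of "int n"] assms by auto
  define x where "x = log2_scaled b * 256 div 5 + 1"
  define F where "F = floor_sum a small_primes"
  define u where "u = log2_ub 12 x"
  have *: "0 < a" "b < 2048" "x < 2097152" "4615 * 32 * b * u < 6658 * 4096 * (32 * F - 45 * b)"
    using ab(1) by (simp_all add: good_interval_def x_def F_def u_def Let_def)
  have "F \<le> sum_list (map (\<lambda>p. a div p) small_primes)"
    unfolding F_def using \<open>0 < a\<close> by (intro floor_sum_le) (auto simp: set_small_primes prime_gt_0_nat)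
  also have "\<dots> \<le> sum_list (map (\<lambda>p. int n div p) small_primes)"
    using ab by (intro sum_list_mono zdiv_mono1) (auto simp: set_small_primes prime_gt_0_nat)
  also have "\<dots> = (\<Sum>p\<in>primes_le 1024. int (n div p))"
    by (simp add: sum_small_primes[symmetric] zdiv_int)
  finally have "real_of_int F \<le> (\<Sum>p\<in>primes_le 1024. real (n div p))"
    by (metis (mono_tags, lifting) of_int_le_iff of_int_of_nat_eq of_int_sum sum.cong)
  then have T: "real_of_int F \<le> (\<Sum>p\<in>primes_le n. real (n div p))"
    using sum_primes_le_mono_neutral[of n 1024] assms by simp
  have lnn: "ln 32 < ln (real n)" "0 < ln (real n)" using assms by simp_all
  have "log 2 (real n) \<le> log 2 (real_of_int b)" using ab assms by simp
  also have "\<dots> \<le> real_of_int (log2_scaled b) / 4096" using * ab assms by (intro log2_scaled) auto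
  \<comment> \<open>The factor 256 changes the scale from \<open>2^12\<close> to
    \<open>2^20\<close>; the \<open>+ 1\<close> in \<open>x\<close> rounds up.\<close>
  also have "\<dots> \<le> 5 * (real_of_int x / 1048576)"
  proof -
    have "log2_scaled b * 256 \<le> 5 * x" unfolding x_def by presburger
    then have "real_of_int (log2_scaled b * 256) \<le> real_of_int (5 * x)" by (simp only: of_int_le_iff)
    then show ?thesis by simp
  qed
  finally have le: "ln (real n) / ln 32 \<le> real_of_int x / 1048576"
    by (simp add: log_def ln_powers_of_2 field_simps)
  moreover have gt: "1 < ln (real n) / ln 32" using lnn by simp
  ultimately have "0 < x" by (smt (verit) of_int_le_0_iff divide_nonpos_pos)
  have "log 2 (ln (real n) / ln 32) \<le> log 2 (real_of_int x / 1048576)"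
    using le gt \<open>0 < x\<close> by (intro log_mono) linarith+
  also have "\<dots> \<le> real_of_int u / 2 ^ 12"
    unfolding u_def using \<open>0 < x\<close> * by (intro log2_ub) auto
  finally have u: "log 2 (ln (real n) / ln 32) \<le> real_of_int u / 4096" by simp
  \<comment> \<open>Positivity, due to \<open>n > 32\<close>, allows replacing \<open>ln 2\<close>
    by its upper bound in the product below.\<close>
  moreover have "0 < log 2 (ln (real n) / ln 32)" using gt by (subst zero_less_log_cancel_iff) linarith+
  ultimately have "0 \<le> real_of_int u" by simp
  have "ln (ln (real n)) - ln (ln 32) = log 2 (ln (real n) / ln 32) * ln 2"
    using lnn by (simp add: log_def ln_div)
  also have "\<dots> \<le> real_of_int u / 4096 * (4615 / 6658)"
    using u ln_2_le \<open>0 \<le> real_of_int u\<close> by (intro mult_mono) auto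
  finally have "real n * (45 / 32 + (ln (ln (real n)) - ln (ln 32))) \<le> real_of_int b * (45 / 32 + real_of_int u / 4096 * (4615 / 6658))"
    using ab \<open>0 \<le> real_of_int u\<close> assms by (intro mult_mono add_mono add_nonneg_nonneg) auto
  also have "\<dots> < real_of_int F"
  proof -
    have "real_of_int (4615 * 32 * b * u) < real_of_int (6658 * 4096 * (32 * F - 45 * b))"
      using * by (simp only: of_int_less_iff)
    then show ?thesis by (simp add: field_simps)
  qed
  finally show ?thesis using T by (simp add: algebra_simps)
qed

section \<open>The lower bound below 32\<close>

lemma primes_le_32: "primes_le 32 = {2, 3, 5, 7, 11, 13, 17, 19, 23, 29, 31}"
proof -
  have "primes_le 32 = Set.filter prime {..32}" by auto
  also have "\<dots> = {2, 3, 5, 7, 11, 13, 17, 19, 23, 29, 31}"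
    by code_simp
  finally show ?thesis .
qed

lemma floor_sum_small:
  assumes "n \<le> 32"
  shows "(\<Sum>p\<in>primes_le n. real (n div p)) = real (n div 2 + n div 3 + n div 5 + n div 7 + n div 11
    + n div 13 + n div 17 + n div 19 + n div 23 + n div 29 + n div 31)"
  unfolding sum_primes_le_mono_neutral[OF assms] primes_le_32 by simp

text \<open>The tangent to the concave function log log at \<open>2 ^ k\<close>, obtained from
  \<open>ln y \<le> y - 1\<close> applied first to \<open>n / 2 ^ k\<close> and then to
  \<open>ln n / (k * ln 2)\<close>.\<close>

lemma ln_ln_le_tangent:
  assumes "n \<ge> 2" "k > 0"
  shows "ln (ln (real n)) - ln (ln 32) \<le> ln (real k / 5) + (real n / 2 ^ k - 1) / real k * (1 / ln 2)"
proof -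
  have pos: "0 < ln (real n)" "0 < real k * ln 2" using assms by auto
  have "ln (ln (real n) / (real k * ln 2)) \<le> ln (real n) / (real k * ln 2) - 1"
    using pos by (intro ln_le_minus_one) auto
  moreover have "ln (real n) - real k * ln 2 \<le> real n / 2 ^ k - 1"
    using ln_le_minus_one[of "real n / 2 ^ k"] assms by (simp add: ln_div ln_realpow)
  then have "(ln (real n) - real k * ln 2) / (real k * ln 2) \<le> (real n / 2 ^ k - 1) / (real k * ln 2)"
    using pos by (intro divide_right_mono) auto
  moreover have "ln (real n) / (real k * ln 2) - 1 = (ln (real n) - real k * ln 2) / (real k * ln 2)"
    using pos assms by (simp add: diff_divide_distrib)
  moreover have "ln (ln (real n) / (real k * ln 2)) = ln (ln (real n)) - ln (ln 32) - ln (real k / 5)"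
    using pos assms by (simp add: ln_powers_of_2 ln_div ln_mult)
  ultimately show ?thesis by simp
qed

lemma inverse_ln_2_bounds: "6658 / 4615 \<le> 1 / ln (2 :: real)" "1 / ln (2 :: real) \<le> 443 / 307"
  using ln_2_bounds by (simp_all add: field_simps)

lemma lower_bound_small:
  assumes "2 \<le> n" "n < 32"
  shows "real n * (45 / 32 + ln (ln (real n)) - ln (ln 32)) < (\<Sum>p\<in>primes_le n. real (n div p))"
proof -
  define f where "f = (\<lambda>n. n div 2 + n div 3 + n div 5 + n div 7 + n div 11
    + n div 13 + n div 17 + n div 19 + n div 23 + n div 29 + n div (31 :: nat))"
  define i where "i = 1 / ln (2 :: real)"
  have i: "6658 / 4615 \<le> i" "i \<le> 443 / 307" using inverse_ln_2_bounds by (simp_all add: i_def)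
  have T: "(\<Sum>p\<in>primes_le n. real (n div p)) = real (f n)"
    using floor_sum_small[of n] assms by (simp add: f_def)
  have main: "real n * (45 / 32 + ln (ln (real n)) - ln (ln 32)) < real (f n)"
    if "k > 0" "ln (real k / 5) \<le> c" "45 / 32 + c + (real n / 2 ^ k - 1) / real k * i < real (f n) / real n" for k c
  proof -
    have "45 / 32 + ln (ln (real n)) - ln (ln 32) < real (f n) / real n"
      using ln_ln_le_tangent[of n k] that assms by (simp add: i_def)
    then show ?thesis using assms by (simp add: pos_less_divide_eq mult.commute)
  qed
  have ln5: "ln (2 / 5) \<le> (- 6 / 7 :: real)" "ln (3 / 5) \<le> (- 1 / 2 :: real)" "ln (4 / 5) \<le> (- 2 / 9 :: real)"
    using ln_ge_rational[of "5 / 2"] ln_ge_rational[of "5 / 3"] ln_ge_rational[of "5 / 4"]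
    by (simp_all add: ln_div)
  \<comment> \<open>Ranges served by the tangents at 4, 8, 16 and 32; the last one is exact at 32,
    where equality holds.\<close>
  consider "n \<in> {2..6}" | "n \<in> {7..10}" | "n \<in> {11..22}" | "n \<in> {23..31}" using assms by force
  then have "real n * (45 / 32 + ln (ln (real n)) - ln (ln 32)) < real (f n)"
  proof cases
    case 1
    then have "n \<in> set [2..<7]" unfolding set_upt by simp
    then have "n = 2 \<or> n = 3 \<or> n = 4 \<or> n = 5 \<or> n = 6" by simp
    then have "45 / 32 + (- 6 / 7) + (real n / 2 ^ 2 - 1) / real 2 * i < real (f n) / real n"
      using i by (elim disjE) (simp_all add: f_def)
    then show ?thesis by (intro main[of 2 "- 6 / 7"]) (use ln5 in auto)
  next
    case 2
    then have "n \<in> set [7..<11]" unfolding set_upt by simp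
    then have "n = 7 \<or> n = 8 \<or> n = 9 \<or> n = 10" by simp
    then have "45 / 32 + (- 1 / 2) + (real n / 2 ^ 3 - 1) / real 3 * i < real (f n) / real n"
      using i by (elim disjE) (simp_all add: f_def)
    then show ?thesis by (intro main[of 3 "- 1 / 2"]) (use ln5 in auto)
  next
    case 3
    then have "n \<in> set [11..<23]" unfolding set_upt by simp
    then have "n = 11 \<or> n = 12 \<or> n = 13 \<or> n = 14 \<or> n = 15 \<or> n = 16 \<or> n = 17 \<or> n = 18 \<or> n = 19
      \<or> n = 20 \<or> n = 21 \<or> n = 22" by simp
    then have "45 / 32 + (- 2 / 9) + (real n / 2 ^ 4 - 1) / real 4 * i < real (f n) / real n"
      using i by (elim disjE) (simp_all add: f_def)
    then show ?thesis by (intro main[of 4 "- 2 / 9"]) (use ln5 in auto)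
  next
    case 4
    then have "n \<in> set [23..<32]" unfolding set_upt by simp
    then have "n = 23 \<or> n = 24 \<or> n = 25 \<or> n = 26 \<or> n = 27 \<or> n = 28 \<or> n = 29 \<or> n = 30 \<or> n = 31" by simp
    then have "45 / 32 + 0 + (real n / 2 ^ 5 - 1) / real 5 * i < real (f n) / real n"
      using i by (elim disjE) (simp_all add: f_def)
    then show ?thesis by (intro main[of 5 0]) auto
  qed
  then show ?thesis by (simp only: T)
qed

lemma lower_bound:
  assumes "2 \<le> n" "n \<noteq> 32"
  shows "real n * (45 / 32 + ln (ln (real n)) - ln (ln 32)) < (\<Sum>p\<in>primes_le n. real (n div p))"
proof -
  consider "n < 32" | "33 \<le> n" "n < 1024" | "1024 \<le> n" using assms by linarith
  then show ?thesis
    using assms by cases (simp_all only: lower_bound_small lower_bound_middle lower_bound_large)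
qed

section \<open>The upper bound\<close>

lemma ln_5_ge: "2 * ln 2 + 2 / 9 \<le> ln (5 :: real)"
  using ln_ge_rational[of "5 / 4"] by (simp add: ln_div ln_powers_of_2)

lemma upper_bound_small:
  assumes "3 \<le> n" "n < 32"
  shows "(\<Sum>p\<in>primes_le n. real (n div p)) < real n * (1 / 2 + ln (ln (real n)) - ln (ln 2))"
proof -
  define f where "f = (\<lambda>n. n div 2 + n div 3 + n div 5 + n div 7 + n div 11
    + n div 13 + n div 17 + n div 19 + n div 23 + n div 29 + n div (31 :: nat))"
  have T: "(\<Sum>p\<in>primes_le n. real (n div p)) = real (f n)"
    using floor_sum_small[of n] assms by (simp add: f_def)
  \<comment> \<open>From \<open>2 powr k \<le> n\<close> follows
    \<open>ln (ln n) - ln (ln 2) \<ge> ln k\<close>; the exponents \<open>3 / 2\<close>, 2 and 3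
    will do.\<close>
  have main: "real (f n) < real n * (1 / 2 + ln (ln (real n)) - ln (ln 2))"
    if "2 powr k \<le> real n" "0 < k" "c \<le> ln k" "real (f n) / real n < 1 / 2 + c" for k c
  proof -
    have "ln (2 powr k) \<le> ln (real n)" using that assms by (intro ln_mono) auto
    then have "k * ln 2 \<le> ln (real n)" by (simp add: ln_powr)
    then have "ln (k * ln 2) \<le> ln (ln (real n))" using that by (intro ln_mono) auto
    then have "c \<le> ln (ln (real n)) - ln (ln 2)" using that by (simp add: ln_mult)
    then have "real (f n) / real n < 1 / 2 + ln (ln (real n)) - ln (ln 2)" using that by simp
    then show ?thesis using assms by (simp add: pos_divide_less_eq mult.commute)
  qed
  have ln32: "2 / 5 \<le> ln (3 / 2 :: real)" using ln_ge_rational[of "3 / 2"] by simp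
  consider "n \<in> {3..4}" | "n \<in> {5..10}" | "n \<in> {11..31}" using assms by force
  then have "real (f n) < real n * (1 / 2 + ln (ln (real n)) - ln (ln 2))"
  proof cases
    case 1
    then have "n \<in> set [3..<5]" unfolding set_upt by simp
    then have "n = 3 \<or> n = 4" by simp
    then have "real (f n) / real n < 1 / 2 + 2 / 5" by (elim disjE) (simp_all add: f_def)
    moreover have "2 powr (3 / 2) \<le> real n"
    proof -
      have "(2 powr (3 / 2)) \<le> (3 :: real)"
        by (rule power2_le_imp_le) (simp_all flip: powr_numeral add: powr_powr)
      then show ?thesis using assms by linarith
    qed
    ultimately show ?thesis by (intro main[of "3 / 2" "2 / 5"]) (use ln32 in auto)
  next
    case 2
    then have "n \<in> set [5..<11]" unfolding set_upt by simp
    then have "n = 5 \<or> n = 6 \<or> n = 7 \<or> n = 8 \<or> n = 9 \<or> n = 10" by simp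
    then have "real (f n) / real n < 1 / 2 + 69 / 100" by (elim disjE) (simp_all add: f_def)
    moreover have "2 powr 2 \<le> real n" using 2 by (auto simp flip: powr_numeral)
    ultimately show ?thesis by (intro main[of 2 "69 / 100"]) (use ln_2_ge in auto)
  next
    case 3
    then have "n \<in> set [11..<32]" unfolding set_upt by simp
    then have "n = 11 \<or> n = 12 \<or> n = 13 \<or> n = 14 \<or> n = 15 \<or> n = 16 \<or> n = 17 \<or> n = 18 \<or> n = 19
      \<or> n = 20 \<or> n = 21 \<or> n = 22 \<or> n = 23 \<or> n = 24 \<or> n = 25 \<or> n = 26 \<or> n = 27 \<or> n = 28
      \<or> n = 29 \<or> n = 30 \<or> n = 31" by simp
    then have "real (f n) / real n < 1 / 2 + 109 / 100" by (elim disjE) (simp_all add: f_def)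
    moreover have "109 / 100 \<le> ln (3 :: real)" using ln32 ln_2_ge by (simp add: ln_div)
    moreover have "2 powr 3 \<le> real n" using 3 by (auto simp flip: powr_numeral)
    ultimately show ?thesis by (intro main[of 3 "109 / 100"]) auto
  qed
  then show ?thesis by (simp only: T)
qed

text \<open>Floors are dropped and \<open>1 / p\<close> is summed by parts from 32. The constants
  add up to \<open>1 + 0.152 + 0.923 - 1.6 = 0.475 < 1/2\<close>, where 1.6 is a lower bound for
  \<open>ln 5\<close>.\<close>

lemma upper_bound_large:
  assumes "32 \<le> n"
  shows "(\<Sum>p\<in>primes_le n. real (n div p)) < real n * (1 / 2 + ln (ln (real n)) - ln (ln 2))"
proof -
  \<comment> \<open>The error \<open>ln 4 - 1 + (1 + ln j) / j\<close> of
    \<open>sum_ln_div_le\<close>, taken at \<open>j = 32\<close>.\<close>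
  define C where "C = 2 * ln 2 - 1 + 1 / 32 + 5 * ln 2 / (32 :: real)"
  define R where "R = (\<Sum>p\<in>primes_le 32. (1 - ln (real p) / ln (real 32)) / real p)"
  have C: "(\<Sum>p\<in>primes_le j. ln (real p) / real p) \<le> ln (real j) + C" if "32 \<le> j" for j
  proof -
    have "ln (real j) - ln 32 \<le> real j / 32 - 1"
      using ln_le_minus_one[of "real j / 32"] that by (simp add: ln_div)
    then have "(1 + ln (real j)) / real j \<le> (ln 32 + real j / 32) / real j"
      by (intro divide_right_mono) auto
    also have "\<dots> = ln 32 / real j + 1 / 32" using that by (simp add: add_divide_distrib)
    also have "\<dots> \<le> ln 32 / 32 + 1 / 32"
      using that by (intro add_mono divide_left_mono) auto
    finally show ?thesis using sum_ln_div_le[of j] that by (simp add: C_def ln_powers_of_2)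
  qed
  have "(\<Sum>p\<in>primes_le n. 1 / real p)
    = (\<Sum>p\<in>primes_le n. ln (real p) / real p / ln (real (max p 32)) +
        (if p \<le> 32 then (1 - ln (real p) / ln (real 32)) / real p else 0))"
  proof (intro sum.cong refl)
    fix p assume p: "p \<in> primes_le n"
    then have "real p > 0" "ln (real p) > 0" using ln_prime_pos by (auto intro: prime_gt_0_nat)
    then show "1 / real p = ln (real p) / real p / ln (real (max p 32)) +
        (if p \<le> 32 then (1 - ln (real p) / ln (real 32)) / real p else 0)"
      by (auto simp: max_def diff_divide_distrib)
  qed
  also have "\<dots> = (\<Sum>p\<in>primes_le n. ln (real p) / real p / ln (real (max p 32))) + R"
  proof -
    have "primes_le n \<inter> {p. p \<le> 32} = primes_le 32" using assms by auto
    then show ?thesis using finite_primes_le by (simp add: sum.distrib sum.If_cases R_def)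
  qed
  also have "\<dots> \<le> 1 + ln (ln (real n)) - ln (ln (real 32)) + C / ln (real 32) + R"
    using assms C by (intro add_right_mono weighted_reciprocal_sum_le) auto
  also have "\<dots> < 1 / 2 + ln (ln (real n)) - ln (ln 2)"
  proof -
    have "R \<le> 923 / 1000"
    proof -
      define g where "g p = (1 - ln (real p) / ln (real 32)) / real p" for p :: nat
      \<comment> \<open>Bounds \<open>log 2 p\<close> below by the half-integer
        \<open>e / 2\<close>, so no logarithms of primes are needed.\<close>
      have *: "g p \<le> (1 - real e / 10) / real p" if "2 ^ e \<le> p\<^sup>2" for e p :: nat
      proof -
        have "p > 0" using that by (cases p) auto
        have "real (2 ^ e) \<le> real (p\<^sup>2)" using that of_nat_le_iff by blast
        then have "ln (2 ^ e) \<le> ln (real p ^ 2)" using \<open>p > 0\<close> by (intro ln_mono) auto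
        then have "real e * ln 2 \<le> 2 * ln (real p)" using \<open>p > 0\<close> by (simp add: ln_realpow)
        then have "real e / 10 \<le> ln (real p) / ln (real 32)" by (simp add: ln_powers_of_2 field_simps)
        then show ?thesis unfolding g_def by (intro divide_right_mono) auto
      qed
      have "R = g 2 + g 3 + g 5 + g 7 + g 11 + g 13 + g 17 + g 19 + g 23 + g 29 + g 31"
        unfolding R_def primes_le_32 g_def[symmetric] by simp
      then show ?thesis
        using *[of 2 2] *[of 3 3] *[of 4 5] *[of 5 7] *[of 6 11] *[of 7 13] *[of 8 17] *[of 8 19] *[of 8 23]
          *[of 9 29] *[of 9 31]
        by simp
    qed
    moreover have "C / ln (real 32) \<le> 152 / 1000"
    proof -
      have "C / ln (real 32) = 69 / 160 - 31 / 160 * (1 / ln 2)"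
        by (simp add: C_def ln_powers_of_2 field_simps)
      then show ?thesis using inverse_ln_2_bounds(1) by simp
    qed
    moreover have "ln (ln (real 32)) - ln (ln 2) = ln 5" by (simp add: ln_powers_of_2 ln_mult)
    then have "ln (ln (real 32)) - ln (ln 2) \<ge> 16 / 10" using ln_5_ge ln_2_ge by simp
    ultimately show ?thesis by simp
  qed
  finally have "(\<Sum>p\<in>primes_le n. 1 / real p) < 1 / 2 + ln (ln (real n)) - ln (ln 2)" .
  then have "real n * (\<Sum>p\<in>primes_le n. 1 / real p) < real n * (1 / 2 + ln (ln (real n)) - ln (ln 2))"
    using assms by (intro mult_strict_left_mono) auto
  moreover have "(\<Sum>p\<in>primes_le n. real (n div p)) \<le> (\<Sum>p\<in>primes_le n. real n * (1 / real p))"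
    using of_nat_div_le_of_nat[of n] by (intro sum_mono) simp
  ultimately show ?thesis unfolding sum_distrib_left[symmetric] by linarith
qed

theorem theorem2p1:
  fixes n :: nat
  assumes "n \<ge> 2"
  shows "45 / 32 - ln (ln 32) \<le> (1 / real n) * (\<Sum>k=1..n. real (omega k)) - ln (ln (real n))
    \<and> (1 / real n) * (\<Sum>k=1..n. real (omega k)) - ln (ln (real n)) \<le> 1 / 2 - ln (ln 2)
    \<and> (45 / 32 - ln (ln 32) = (1 / real n) * (\<Sum>k=1..n. real (omega k)) - ln (ln (real n)) \<longleftrightarrow> n = 32)
    \<and> ((1 / real n) * (\<Sum>k=1..n. real (omega k)) - ln (ln (real n)) = 1 / 2 - ln (ln 2) \<longleftrightarrow> n = 2)"
proof -
  define S where "S = (\<Sum>p\<in>primes_le n. real (n div p))"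
  define A where "A = 1 / real n * S - ln (ln (real n))"
  have lower: "45 / 32 - ln (ln 32) < A" if "n \<noteq> 32"
  proof -
    have "45 / 32 + ln (ln (real n)) - ln (ln 32) < S / real n"
      using lower_bound[of n] that assms by (simp add: S_def pos_less_divide_eq mult.commute)
    then show ?thesis by (simp add: A_def)
  qed
  have upper: "A < 1 / 2 - ln (ln 2)" if "n \<noteq> 2"
  proof -
    have "S < real n * (1 / 2 + ln (ln (real n)) - ln (ln 2))"
      using upper_bound_small[of n] upper_bound_large[of n] that assms unfolding S_def by linarith
    then have "S / real n < 1 / 2 + ln (ln (real n)) - ln (ln 2)"
      using assms by (simp add: pos_divide_less_eq mult.commute)
    then show ?thesis by (simp add: A_def)
  qed
  \<comment> \<open>The prime sum is 45 at \<open>n = 32\<close> and 1 at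
    \<open>n = 2\<close>.\<close>
  have "A = 45 / 32 - ln (ln 32)" if "n = 32"
    using floor_sum_small[of 32] that by (simp add: A_def S_def)
  moreover have "A = 1 / 2 - ln (ln 2)" if "n = 2"
    using floor_sum_small[of 2] that by (simp add: A_def S_def)
  \<comment> \<open>The constants are abstracted to \<open>c\<close> and \<open>d\<close>, leaving
    pure order reasoning.\<close>
  ultimately have "c \<le> A \<and> A \<le> d \<and> (c = A \<longleftrightarrow> n = 32) \<and> (A = d \<longleftrightarrow> n = 2)"
    if "c = 45 / 32 - ln (ln 32)" "d = 1 / 2 - ln (ln 2)" for c d
    using lower upper unfolding that[symmetric] by (metis less_imp_le order_refl less_irrefl)
  from this[OF refl refl] show ?thesis by (simp only: A_def S_def sum_omega)
qed

end
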